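(* Let $X$ be an abstract state space, let $A,B$ be linear operators on $X$ satisfying Kato's conditions, and let $(V(t))_{t\ge 0}$ be the associated perturbed (Kato) semigroup. Fix $\lambda>0$. The following are equivalent: (i) $(V(t))_{t\ge0}$ is dishonest. (ii) There exists $f_\lambda\in X^*\setminus\{0\}$ such that the sequence $((BR(\lambda,A))^{*n}f_\lambda)_n$ is weak$^*$-convergent and its weak$^*$ limit is nonzero. (iii) There exists $f_\lambda\in X^*_+\setminus\{0\}$ such that the sequence $((BR(\lambda,A))^{*n}f_\lambda)_n$ is weak$^*$-convergent and its weak$^*$ limit is nonzero. (iv) There exists $f_\lambda\in X^*_+\setminus\{0\}$ such that $(BR(\lambda,A))^*f_\lambda\ge f_\lambda$. (v) There exists $f_\lambda\in X^*_+\setminus\{0\}$ (in the domain of $(A+B)^*$) such that $(A+B)^*f_\lambda\ge\lambda f_\lambda$. (vi) There exists $f_\lambda\in X^*_+\setminus\{0\}$ such that $(A+B)^*f_\lambda=\lambda f_\lambda$. (vii) There exists $f_\lambda\in X^*\setminus\{0\}$ such that $(A+B)^*f_\lambda=\lambda f_\lambda$.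
   Context: An abstract state space is a real ordered Banach space $X$ with closed generating positive cone $X_+$ on which the norm is additive: $\|u+v\|=\|u\|+\|v\|$ for $u,v\in X_+$. $X^*_+$ is the dual cone of positive functionals, with the induced order on $X^*$. $\Psi\in X^*$ is the linear functional with $\langle\Psi,u\rangle=\|u\|$ for $u\in X_+$. $D(A)_+=D(A)\cap X_+$, $R(\lambda,A)=(\lambda-A)^{-1}$. An operator $T$ is substochastic if it is positive and $\|Tu\|\le\|u\|$ for $u\in X_+$; a semigroup is substochastic if each of its operators is. Kato's conditions on $A,B$ with $D(A)\subseteq D(B)\subseteq X$: (1) $A$ generates a substochastic $C_0$-semigroup; (2) $Bu\ge0$ for $u\in D(A)_+$; (3) $\langle\Psi,(A+B)u\rangle\le0$ for all $u\in D(A)_+$. Here $A+B$ has domain $D(A)$ and $(A+B)^*$ is its adjoint in $X^*$. Kato's Theorem (known): under these conditions there is an extension $G$ of $A+B$ generating a substochastic $C_0$-semigroup $(V(t))_{t\ge0}$ (the perturbed, or Kato, semigroup), with $R(\lambda,G)u=\sum_{k\ge0}R(\lambda,A)(BR(\lambda,A))^ku$ for $\lambda>0$, $u\in X$; it is the minimal substochastic $C_0$-semigroup whose generator extends $A+B$. Honesty: put $a(u)=-\langle\Psi,Au+Bu\rangle$ for $u\in D(A)$ and define $\bar a:D(G)\to\mathbb R$ by $\bar a(R(\lambda,G)u)=\sum_{k\ge0}a\big(R(\lambda,A)(BR(\lambda,A))^ku\big)$, $u\in X$ (well defined and independent of $\lambda>0$). $(V(t))_{t\ge0}$ is honest if $\|V(t)u\|-\|u\|=-\bar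 a\big(\int_0^tV(s)u\,ds\big)$ for all $t\ge0$, $u\in X_+$; otherwise it is dishonest. *)

theory Defs
  imports "HOL-Analysis.Analysis"
begin

section \<open>Abstract state spaces\<close>

text \<open>The cone is \<open>{u. 0 \<le> u}\<close>; that it is a proper convex cone is part of
  \<^class>\<open>ordered_real_vector\<close>.\<close>

class abstract_state_space = banach + ordered_real_vector +
  assumes closed_positive_cone: "closed {u. 0 \<le> u}"
    and positive_cone_generating: "\<exists>p n. 0 \<le> p \<and> 0 \<le> n \<and> u = p - n"
    and norm_additive: "0 \<le> u \<Longrightarrow> 0 \<le> v \<Longrightarrow> norm (u + v) = norm u + norm v"

type_synonym 'a dual = "'a \<Rightarrow>\<^sub>L real"

definition dual_cone :: "'a::abstract_state_space dual set" where
  "dual_cone = {f. \<forall>u\<ge>0. 0 \<le> blinfun_apply f u}"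

definition dual_le :: "'a::abstract_state_space dual \<Rightarrow> 'a dual \<Rightarrow> bool" where
  "dual_le f g \<longleftrightarrow> g - f \<in> dual_cone"

definition Psi :: "'a::abstract_state_space dual" where
  "Psi = (THE f. \<forall>u\<ge>0. blinfun_apply f u = norm u)"

text \<open>On the dual of \<open>'a\<close> the strong operator topology is the topology of pointwise convergence
  on \<open>'a\<close>, that is, the weak* topology.\<close>

abbreviation weak_star_topology :: "'a::real_normed_vector dual topology" where
  "weak_star_topology \<equiv> strong_operator_topology"

lemma limitin_weak_star_iff:
  fixes F :: "'b \<Rightarrow> 'a::real_normed_vector dual"
  shows "limitin weak_star_topology F f net \<longleftrightarrow> (\<forall>u. ((\<lambda>n. F n u) \<longlongrightarrow> f u) net)"
proof
  assume L: "limitin weak_star_topology F f net"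
  show "\<forall>u. ((\<lambda>n. F n u) \<longlongrightarrow> f u) net"
  proof
    fix u
    have "limitin euclidean ((\<lambda>g. blinfun_apply g u) \<circ> F) (f u) net"
      using continuous_map_limit[OF strong_operator_topology_continuous_evaluation L] by simp
    then show "((\<lambda>n. F n u) \<longlongrightarrow> f u) net"
      by (simp add: o_def)
  qed
next
  assume P: "\<forall>u. ((\<lambda>n. F n u) \<longlongrightarrow> f u) net"
  then have lim: "((\<lambda>n. blinfun_apply (F n)) \<longlongrightarrow> blinfun_apply f) net"
    by (simp add: limitin_componentwise flip: limitin_canonical_iff euclidean_product_topology)
  show "limitin weak_star_topology F f net"
    unfolding limitin_def
  proof (intro conjI allI impI)
    show "f \<in> topspace weak_star_topology"
      by (simp add: strong_operator_topology_topspace)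
  next
    fix U assume "openin weak_star_topology U \<and> f \<in> U"
    then obtain W where W: "open W" "U = blinfun_apply -` W" "blinfun_apply f \<in> W"
      unfolding strong_operator_topology_def openin_pullback_topology by auto
    show "\<forall>\<^sub>F x in net. F x \<in> U"
      using topological_tendstoD[OF lim W(1,3)] W(2) by simp
  qed
qed


section \<open>Operators with a domain\<close>

text \<open>An operator \<open>T\<close> with domain \<open>D\<close> is a pair of a set \<open>D\<close> and a total function \<open>T\<close>; the values of
  \<open>T\<close> outside \<open>D\<close> carry no meaning.\<close>

definition linear_operator :: "'a::real_vector set \<Rightarrow> ('a \<Rightarrow> 'a) \<Rightarrow> bool" where
  "linear_operator D T \<longleftrightarrow> subspace D \<and>
     (\<forall>u\<in>D. \<forall>v\<in>D. T (u + v) = T u + T v) \<and> (\<forall>c. \<forall>u\<in>D. T (c *\<^sub>R u) = c *\<^sub>R T u)"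

text \<open>\<open>resolvent D T lam\<close> is \<open>R(lam, T) = (lam - T)\<inverse>\<close>, meaningful when \<open>lam - T\<close> is a bijection from \<open>D\<close> onto the
  whole space.\<close>

definition resolvent :: "'a::real_vector set \<Rightarrow> ('a \<Rightarrow> 'a) \<Rightarrow> real \<Rightarrow> 'a \<Rightarrow> 'a" where
  "resolvent D T lam u = (THE v. v \<in> D \<and> lam *\<^sub>R v - T v = u)"

text \<open>\<open>g\<close> is unique in \<open>adjoint_op\<close> when \<open>D\<close> is dense. An everywhere defined operator is treated
  with \<open>D = UNIV\<close>.\<close>

definition adjoint_dom :: "'a::real_normed_vector set \<Rightarrow> ('a \<Rightarrow> 'a) \<Rightarrow> 'a dual set" where
  "adjoint_dom D T = {f. \<exists>g::'a dual. \<forall>u\<in>D. blinfun_apply f (T u) = blinfun_apply g u}"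

definition adjoint_op ::
    "'a::real_normed_vector set \<Rightarrow> ('a \<Rightarrow> 'a) \<Rightarrow> 'a dual \<Rightarrow> 'a dual" where
  "adjoint_op D T f = (THE g. \<forall>u\<in>D. blinfun_apply f (T u) = blinfun_apply g u)"


section \<open>Substochastic semigroups and Kato's conditions\<close>

definition c0_semigroup :: "(real \<Rightarrow> 'a::real_normed_vector \<Rightarrow>\<^sub>L 'a) \<Rightarrow> bool" where
  "c0_semigroup V \<longleftrightarrow> V 0 = id_blinfun \<and> (\<forall>s\<ge>0. \<forall>t\<ge>0. V (s + t) = V s o\<^sub>L V t) \<and>
     (\<forall>u. ((\<lambda>t. V t u) \<longlongrightarrow> u) (at_right 0))"

definition generator_dom :: "(real \<Rightarrow> 'a::real_normed_vector \<Rightarrow>\<^sub>L 'a) \<Rightarrow> 'a set" where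
  "generator_dom V = {u. \<exists>v. ((\<lambda>t. (V t u - u) /\<^sub>R t) \<longlongrightarrow> v) (at_right 0)}"

definition generator :: "(real \<Rightarrow> 'a::real_normed_vector \<Rightarrow>\<^sub>L 'a) \<Rightarrow> 'a \<Rightarrow> 'a" where
  "generator V u = Lim (at_right 0) (\<lambda>t. (V t u - u) /\<^sub>R t)"

definition substochastic :: "('a::abstract_state_space \<Rightarrow>\<^sub>L 'a) \<Rightarrow> bool" where
  "substochastic T \<longleftrightarrow> (\<forall>u\<ge>0. 0 \<le> T u) \<and> (\<forall>u\<ge>0. norm (T u) \<le> norm u)"

definition substochastic_semigroup :: "(real \<Rightarrow> 'a::abstract_state_space \<Rightarrow>\<^sub>L 'a) \<Rightarrow> bool" where
  "substochastic_semigroup V \<longleftrightarrow> c0_semigroup V \<and> (\<forall>t\<ge>0. substochastic (V t))"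

definition generates_substochastic :: "'a::abstract_state_space set \<Rightarrow> ('a \<Rightarrow> 'a) \<Rightarrow> bool" where
  "generates_substochastic D T \<longleftrightarrow>
     (\<exists>U. substochastic_semigroup U \<and> D = generator_dom U \<and> (\<forall>u\<in>D. T u = generator U u))"

definition kato_conditions ::
    "'a::abstract_state_space set \<Rightarrow> ('a \<Rightarrow> 'a) \<Rightarrow> 'a set \<Rightarrow> ('a \<Rightarrow> 'a) \<Rightarrow> bool" where
  "kato_conditions DA A DB B \<longleftrightarrow>
     linear_operator DA A \<and> linear_operator DB B \<and> DA \<subseteq> DB \<and>
     generates_substochastic DA A \<and>
     (\<forall>u\<in>DA. 0 \<le> u \<longrightarrow> 0 \<le> B u) \<and>
     (\<forall>u\<in>DA. 0 \<le> u \<longrightarrow> blinfun_apply Psi (A u + B u) \<le> 0)"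


section \<open>The Kato semigroup and honesty\<close>

text \<open>\<open>BR(lam, A)\<close>, and the \<open>k\<close>-th term of the series for \<open>R(lam, G)u\<close>.\<close>

definition BR :: "'a::real_vector set \<Rightarrow> ('a \<Rightarrow> 'a) \<Rightarrow> ('a \<Rightarrow> 'a) \<Rightarrow> real \<Rightarrow> 'a \<Rightarrow> 'a" where
  "BR DA A B lam = B \<circ> resolvent DA A lam"

definition kato_term ::
    "'a::real_vector set \<Rightarrow> ('a \<Rightarrow> 'a) \<Rightarrow> ('a \<Rightarrow> 'a) \<Rightarrow> real \<Rightarrow> 'a \<Rightarrow> nat \<Rightarrow> 'a" where
  "kato_term DA A B lam u k = resolvent DA A lam ((BR DA A B lam ^^ k) u)"

text \<open>At most one \<open>V\<close> satisfies this, as the resolvent determines the semigroup; under Kato's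
  conditions one exists by Kato's theorem, and it is then the minimal substochastic semigroup
  whose generator extends \<open>A + B\<close>.\<close>

definition kato_semigroup ::
    "'a::abstract_state_space set \<Rightarrow> ('a \<Rightarrow> 'a) \<Rightarrow> ('a \<Rightarrow> 'a) \<Rightarrow> (real \<Rightarrow> 'a \<Rightarrow>\<^sub>L 'a) \<Rightarrow> bool" where
  "kato_semigroup DA A B V \<longleftrightarrow> substochastic_semigroup V \<and>
     DA \<subseteq> generator_dom V \<and> (\<forall>u\<in>DA. generator V u = A u + B u) \<and>
     (\<forall>lam>0. \<forall>u. kato_term DA A B lam u sums resolvent (generator_dom V) (generator V) lam u)"

definition kato_a :: "('a::abstract_state_space \<Rightarrow> 'a) \<Rightarrow> ('a \<Rightarrow> 'a) \<Rightarrow> 'a \<Rightarrow> real" where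
  "kato_a A B u = - blinfun_apply Psi (A u + B u)"

text \<open>The value at \<open>v\<close> is the one forced by every representation \<open>v = R(lam, G)u\<close> with \<open>lam > 0\<close>;
  each \<open>v\<close> in the domain of \<open>G\<close> has such representations, all giving the same value.\<close>

definition kato_abar ::
    "'a::abstract_state_space set \<Rightarrow> ('a \<Rightarrow> 'a) \<Rightarrow> ('a \<Rightarrow> 'a) \<Rightarrow> (real \<Rightarrow> 'a \<Rightarrow>\<^sub>L 'a) \<Rightarrow> 'a \<Rightarrow> real"
  where
  "kato_abar DA A B V v = (THE r. \<forall>lam>0. \<forall>u.
     resolvent (generator_dom V) (generator V) lam u = v \<longrightarrow>
     (\<lambda>k. kato_a A B (kato_term DA A B lam u k)) sums r)"

definition honest ::
    "'a::abstract_state_space set \<Rightarrow> ('a \<Rightarrow> 'a) \<Rightarrow> ('a \<Rightarrow> 'a) \<Rightarrow> (real \<Rightarrow> 'a \<Rightarrow>\<^sub>L 'a) \<Rightarrow> bool" where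
  "honest DA A B V \<longleftrightarrow> (\<forall>t\<ge>0. \<forall>u\<ge>0.
     norm (V t u) - norm u = - kato_abar DA A B V (integral {0..t} (\<lambda>s. V s u)))"

end

theory Submission
  imports Defs
begin

text \<open>Write \<open>K = B R(lam, A)\<close>. It is positive and contractive on the cone, so
  \<open>L u = lim \<langle>Psi, K^n u\<rangle>\<close> exists and defines a positive functional with \<open>K* L = L\<close>, equivalently
  \<open>(A + B)* L = lam L\<close>. Summing the defining series gives
  \<open>abar v = - \<langle>Psi, G v\<rangle> - L ((lam - G) v)\<close>, where the last term does not depend on \<open>lam\<close>. Hence
  honesty says \<open>L (V t u) - L u = lam L (\<integral> V s u ds)\<close>, the integral being over \<open>[0, t]\<close>. For
  \<open>u \<ge> 0\<close> the right side is then at least \<open>lam t L u\<close>, while the left side is bounded in \<open>t\<close>, so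
  honesty means \<open>L = 0\<close>. If a functional \<open>f\<close> satisfies \<open>\<bar>f u\<bar> \<le> \<bar>f (K^n u)\<bar>\<close> on the cone for all
  \<open>n\<close>, then \<open>\<bar>f u\<bar> \<le> \<parallel>f\<parallel> L u\<close> in the limit; so \<open>L\<close> is nonzero as soon as any of the other
  conditions holds, and conversely \<open>L\<close> itself witnesses all of them.\<close>

section \<open>Abstract state spaces\<close>

lemma positive_limit:
  fixes f :: "'b \<Rightarrow> 'a::abstract_state_space"
  assumes "(f \<longlongrightarrow> l) F" and "\<forall>\<^sub>F x in F. 0 \<le> f x" and "F \<noteq> bot"
  shows "0 \<le> l"
  using Lim_in_closed_set[OF closed_positive_cone, of f F l] assms by simp

lemma positive_suminf:
  fixes f :: "nat \<Rightarrow> 'a::abstract_state_space"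
  assumes "summable f" and "\<And>n. 0 \<le> f n"
  shows "0 \<le> suminf f"
  using summable_LIMSEQ[OF assms(1)]
  by (rule positive_limit) (simp_all add: sum_nonneg assms)

text \<open>Tagged sums of \<open>f\<close> are nonnegative combinations of its values, hence lie in
  the cone. They come arbitrarily close to the integral, and the cone is closed.\<close>

lemma positive_integral:
  fixes f :: "real \<Rightarrow> 'a::abstract_state_space"
  assumes f: "f integrable_on {a..b}" and pos: "\<And>x. x \<in> {a..b} \<Longrightarrow> 0 \<le> f x"
  shows "0 \<le> integral {a..b} f"
proof -
  have "integral {a..b} f \<in> closure {u. 0 \<le> u}"
    unfolding closure_approachable
  proof (intro allI impI)
    fix e :: real assume e: "0 < e"
    obtain \<gamma> where g: "gauge \<gamma>" and
      d: "\<And>\<D>. \<D> tagged_division_of {a..b} \<Longrightarrow> \<gamma> fine \<D> \<Longrightarrow>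
        norm ((\<Sum>(x,k)\<in>\<D>. measure lborel k *\<^sub>R f x) - integral {a..b} f) < e"
      using has_integralD[OF integrable_integral[OF f[folded box_real]] e] unfolding box_real by metis
    obtain p where p: "p tagged_division_of {a..b}" "\<gamma> fine p"
      using fine_division_exists_real[OF g] by blast
    have "0 \<le> (\<Sum>(x,k)\<in>p. measure lborel k *\<^sub>R f x)"
    proof (rule sum_nonneg)
      fix y assume "y \<in> p"
      moreover obtain x k where "y = (x, k)" by fastforce
      ultimately have "x \<in> {a..b}"
        using tagged_division_ofD(2,3)[OF p(1)] by blast
      then show "0 \<le> (case y of (x, k) \<Rightarrow> measure lborel k *\<^sub>R f x)"
        using \<open>y = (x, k)\<close> by (simp add: pos scaleR_nonneg_nonneg)
    qed
    then show "\<exists>y\<in>{u. 0 \<le> u}. dist y (integral {a..b} f) < e"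
      using d[OF p] by (auto simp: dist_norm)
  qed
  then show ?thesis
    by (simp add: closure_closed[OF closed_positive_cone])
qed

section \<open>Norm control in the generating cone\<close>

text \<open>Baire's theorem: the closures of the sets \<open>Q m\<close> cover the space, so one of
  them contains a ball. Vectors near the centre \<open>x\<close> and near \<open>x + y\<close>
  subtract to an approximation of a small \<open>y\<close>, and scaling reaches every
  \<open>u\<close>. The error \<open>e\<close> stays because only the closure of \<open>Q m\<close>
  is known to contain the ball.\<close>

lemma approximate_decomposition:
  "\<exists>c>0. \<forall>u::'a::abstract_state_space. \<forall>e>0. \<exists>p n. 0 \<le> p \<and> 0 \<le> n \<and>
     norm p \<le> c * norm u \<and> norm n \<le> c * norm u \<and> norm (u - (p - n)) < e"
proof -
  define Q :: "nat \<Rightarrow> 'a set" where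
    "Q m = {p - n | p n. 0 \<le> p \<and> 0 \<le> n \<and> norm p \<le> real m \<and> norm n \<le> real m}" for m
  have "u \<in> \<Union> (range (\<lambda>m. closure (Q m)))" for u
  proof -
    obtain p n where pn: "0 \<le> p" "0 \<le> n" "u = p - n"
      using positive_cone_generating by blast
    obtain m where "max (norm p) (norm n) \<le> real m"
      using real_arch_simple by blast
    then have "u \<in> Q m"
      unfolding Q_def using pn by auto
    then show ?thesis
      using closure_subset by blast
  qed
  then have "\<Union> (range (\<lambda>m. closure (Q m))) = UNIV" by blast
  then have "\<exists>m. interior (closure (Q m)) \<noteq> {}"
    using Baire_category_alt[of "euclidean :: 'a topology" "range (\<lambda>m. closure (Q m))"]
    by (force simp: completely_metrizable_space_euclidean)
  then obtain m x where "x \<in> interior (closure (Q m))" by blast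
  then obtain r where r: "0 < r" "ball x r \<subseteq> closure (Q m)"
    by (meson mem_interior)
  \<comment> \<open>Two elements of \<open>Q m\<close> are subtracted, so the positive parts reach
    norm \<open>2 * m\<close>; the extra 1 keeps \<open>M\<close> positive when
    \<open>m = 0\<close>.\<close>
  define M where "M = 2 * real m + 1"
  have ap: "\<exists>p n. 0 \<le> p \<and> 0 \<le> n \<and> norm p \<le> M \<and> norm n \<le> M \<and> norm (y - (p - n)) < e"
    if y: "norm y < r" and e: "0 < e" for y :: 'a and e
  proof -
    have "x + y \<in> closure (Q m)" "x \<in> closure (Q m)"
      using r y by (auto simp: subset_iff dist_norm)
    then obtain a b where "a \<in> Q m" "dist a (x + y) < e/2" "b \<in> Q m" "dist b x < e/2"
      unfolding closure_approachable using e by (meson half_gt_zero)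
    moreover obtain p n where "a = p - n" "0 \<le> p" "0 \<le> n" "norm p \<le> real m" "norm n \<le> real m"
      using \<open>a \<in> Q m\<close> unfolding Q_def by blast
    moreover obtain p' n' where "b = p' - n'" "0 \<le> p'" "0 \<le> n'" "norm p' \<le> real m" "norm n' \<le> real m"
      using \<open>b \<in> Q m\<close> unfolding Q_def by blast
    moreover have "norm (y - ((p + n') - (n + p'))) < e"
    proof -
      have "y - ((p + n') - (n + p')) = (x + y - a) - (x - b)"
        unfolding \<open>a = p - n\<close> \<open>b = p' - n'\<close> by (simp add: algebra_simps)
      moreover have "norm (x + y - a) < e/2" "norm (x - b) < e/2"
        using \<open>dist a (x + y) < e/2\<close> \<open>dist b x < e/2\<close>
        by (simp_all add: dist_norm norm_minus_commute)
      ultimately show ?thesis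
        using norm_triangle_ineq4[of "x + y - a" "x - b"] by (simp only:)
    qed
    ultimately show ?thesis
      by (intro exI[of _ "p + n'"] exI[of _ "n + p'"]) (auto simp: norm_additive M_def)
  qed
  define c where "c = 2 * M / r"
  have M: "0 < M" by (simp add: M_def)
  show ?thesis
  proof (intro exI[of _ c] conjI allI impI)
    show "0 < c" using r M by (simp add: c_def)
    fix u :: 'a and e :: real assume e: "0 < e"
    show "\<exists>p n. 0 \<le> p \<and> 0 \<le> n \<and> norm p \<le> c * norm u \<and> norm n \<le> c * norm u \<and>
        norm (u - (p - n)) < e"
    proof (cases "u = 0")
      case True
      then show ?thesis using e by (intro exI[of _ 0]) simp
    next
      case False
      \<comment> \<open>Dividing by \<open>s\<close> brings \<open>u\<close> to norm
        \<open>r / 2\<close>, inside the ball; \<open>c\<close> is chosen so that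
        \<open>s * M = c * norm u\<close>.\<close>
      define s where "s = 2 * norm u / r"
      have s: "0 < s" using False r by (simp add: s_def)
      have "norm (u /\<^sub>R s) < r"
        using False r by (simp add: s_def field_simps)
      then obtain p n where pn: "0 \<le> p" "0 \<le> n" "norm p \<le> M" "norm n \<le> M"
          "norm (u /\<^sub>R s - (p - n)) < e / s"
        using ap[of "u /\<^sub>R s" "e / s"] e s by auto
      have "u - (s *\<^sub>R p - s *\<^sub>R n) = s *\<^sub>R (u /\<^sub>R s - (p - n))"
        using s by (simp add: algebra_simps)
      then have "norm (u - (s *\<^sub>R p - s *\<^sub>R n)) = s * norm (u /\<^sub>R s - (p - n))"
        using s by simp
      then have "norm (u - (s *\<^sub>R p - s *\<^sub>R n)) < e"
        using pn(5) s by (simp add: field_simps)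
      moreover have "s * M = c * norm u" by (simp add: s_def c_def)
      moreover have "norm (s *\<^sub>R p) \<le> s * M" "norm (s *\<^sub>R n) \<le> s * M"
        using s mult_left_mono[OF pn(3), of s] mult_left_mono[OF pn(4), of s] by simp_all
      moreover have "0 \<le> s *\<^sub>R p" "0 \<le> s *\<^sub>R n"
        using s pn(1,2) by (simp_all add: scaleR_nonneg_nonneg)
      ultimately show ?thesis
        by (intro exI[of _ "s *\<^sub>R p"] exI[of _ "s *\<^sub>R n"]) simp
    qed
  qed
qed

text \<open>An open mapping argument: an approximate decomposition is corrected by decomposing
  the remainder, whose norm halves at each step.\<close>

lemma bounded_decomposition:
  "\<exists>C>0. \<forall>u::'a::abstract_state_space. \<exists>p n. 0 \<le> p \<and> 0 \<le> n \<and> u = p - n \<and>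
     norm p + norm n \<le> C * norm u"
proof -
  obtain c where c: "0 < c" and dec: "\<forall>u::'a. \<forall>e>0. \<exists>p n. 0 \<le> p \<and> 0 \<le> n \<and>
     norm p \<le> c * norm u \<and> norm n \<le> c * norm u \<and> norm (u - (p - n)) < e"
    using approximate_decomposition by blast
  have "\<exists>p n. 0 \<le> p \<and> 0 \<le> n \<and> norm p \<le> c * norm u \<and> norm n \<le> c * norm u \<and>
      norm (u - (p - n)) \<le> norm u / 2" for u :: 'a
  proof (cases "u = 0")
    case True
    then show ?thesis by (intro exI[of _ 0]) simp
  next
    case False
    then have "norm u / 2 > 0" by simp
    then obtain p n where "0 \<le> p" "0 \<le> n" "norm p \<le> c * norm u" "norm n \<le> c * norm u"
        "norm (u - (p - n)) < norm u / 2"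
      using dec by blast
    then show ?thesis
      by (intro exI[of _ p] exI[of _ n]) simp
  qed
  then obtain P N where PN: "\<And>u::'a. 0 \<le> P u" "\<And>u. 0 \<le> N u" "\<And>u. norm (P u) \<le> c * norm u"
      "\<And>u. norm (N u) \<le> c * norm u" "\<And>u. norm (u - (P u - N u)) \<le> norm u / 2"
    by metis
  show ?thesis
  proof (intro exI[of _ "4 * c"] conjI allI)
    \<comment> \<open>Both series below are dominated by \<open>c * norm u\<close> times the powers
      of 1/2, so each contributes at most \<open>2 * c * norm u\<close>.\<close>
    show "0 < 4 * c" using c by simp
    fix u :: 'a
    define w where "w k = ((\<lambda>u. u - (P u - N u)) ^^ k) u" for k
    have w0: "w 0 = u" and wS: "w (Suc k) = w k - (P (w k) - N (w k))" for k
      by (simp_all add: w_def)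
    have wn: "norm (w k) \<le> norm u * (1/2) ^ k" for k
    proof (induction k)
      case (Suc k)
      then show ?case using PN(5)[of "w k"] by (simp add: wS)
    qed (simp add: w0)
    have geo: "(\<lambda>k. (c * norm u) * (1/2) ^ k) sums (2 * c * norm u)"
      using sums_mult[OF geometric_sums[of "1/2 :: real"], of "c * norm u"] by (simp add: mult_ac)
    have main: "summable (\<lambda>k. F (w k)) \<and> norm (\<Sum>k. F (w k)) \<le> 2 * c * norm u"
      if F: "\<And>u. norm (F u) \<le> c * norm u" for F :: "'a \<Rightarrow> 'a"
    proof -
      have b: "norm (F (w k)) \<le> (c * norm u) * (1/2) ^ k" for k
        using order_trans[OF F mult_left_mono[OF wn]] c by (simp add: mult.assoc)
      have s: "summable (\<lambda>k. norm (F (w k)))"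
        by (rule summable_comparison_test'[OF sums_summable[OF geo], of 0]) (simp add: b)
      then have "norm (\<Sum>k. F (w k)) \<le> (\<Sum>k. norm (F (w k)))"
        by (rule summable_norm)
      also have "\<dots> \<le> (\<Sum>k. (c * norm u) * (1/2) ^ k)"
        by (rule suminf_le[OF b s sums_summable[OF geo]])
      also have "\<dots> = 2 * c * norm u" using geo by (rule sums_unique[symmetric])
      finally show ?thesis using summable_norm_cancel[OF s] by blast
    qed
    define p n where "p = (\<Sum>k. P (w k))" and "n = (\<Sum>k. N (w k))"
    have sp: "summable (\<lambda>k. P (w k))" "norm p \<le> 2 * c * norm u"
      and sn: "summable (\<lambda>k. N (w k))" "norm n \<le> 2 * c * norm u"
      using main[of P] main[of N] PN unfolding p_def n_def by blast+
    have "w \<longlonglongrightarrow> 0"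
    proof (rule Lim_null_comparison)
      show "\<forall>\<^sub>F k in sequentially. norm (w k) \<le> norm u * (1/2) ^ k" using wn by simp
      show "(\<lambda>k. norm u * (1/2) ^ k) \<longlonglongrightarrow> 0"
        by (intro tendsto_mult_right_zero LIMSEQ_power_zero) simp
    qed
    then have "(\<lambda>k. w k - w (Suc k)) sums (w 0 - 0)" by (rule telescope_sums')
    then have "(\<lambda>k. P (w k) - N (w k)) sums u" by (simp add: wS w0)
    moreover have "(\<lambda>k. P (w k) - N (w k)) sums (p - n)"
      unfolding p_def n_def using sp sn by (intro sums_diff summable_sums)
    ultimately have "u = p - n" by (rule sums_unique2)
    moreover have "0 \<le> p" "0 \<le> n"
      unfolding p_def n_def using sp(1) sn(1) PN(1,2) by (simp_all add: positive_suminf)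
    moreover have "norm p + norm n \<le> 4 * c * norm u"
      using sp(2) sn(2) by linarith
    ultimately show "\<exists>p n. 0 \<le> p \<and> 0 \<le> n \<and> u = p - n \<and> norm p + norm n \<le> 4 * c * norm u"
      by (intro exI conjI)
  qed
qed

text \<open>One decomposition constant is fixed for the whole type, so that operator bounds can
  mention it. The \<open>itself\<close> argument carries the type.\<close>

definition cone_constant :: "'a::abstract_state_space itself \<Rightarrow> real" where
  "cone_constant _ = (SOME C. C > 0 \<and> (\<forall>u::'a. \<exists>p n. 0 \<le> p \<and> 0 \<le> n \<and> u = p - n \<and>
     norm p + norm n \<le> C * norm u))"

lemma cone_constant:
  shows "cone_constant TYPE('a::abstract_state_space) > 0"
    and "\<exists>p n. 0 \<le> p \<and> 0 \<le> n \<and> (u::'a) = p - n \<and>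
      norm p + norm n \<le> cone_constant TYPE('a) * norm u"
proof -
  have "cone_constant TYPE('a) > 0 \<and> (\<forall>u::'a. \<exists>p n. 0 \<le> p \<and> 0 \<le> n \<and> u = p - n \<and>
     norm p + norm n \<le> cone_constant TYPE('a) * norm u)"
    unfolding cone_constant_def by (rule someI_ex[OF bounded_decomposition])
  then show "cone_constant TYPE('a) > 0" "\<exists>p n. 0 \<le> p \<and> 0 \<le> n \<and> u = p - n \<and>
      norm p + norm n \<le> cone_constant TYPE('a) * norm u"
    by blast+
qed

text \<open>Substochasticity controls norms only on the cone. Splitting a vector with norm control
  turns this into boundedness on the whole space.\<close>

lemma linear_bounded_on_cone:
  fixes T :: "'a::abstract_state_space \<Rightarrow> 'b::real_normed_vector"
  assumes "linear T" and b: "\<And>u. 0 \<le> u \<Longrightarrow> norm (T u) \<le> norm u"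
  shows "norm (T u) \<le> cone_constant TYPE('a) * norm u"
proof -
  obtain p n where pn: "0 \<le> p" "0 \<le> n" "u = p - n"
      "norm p + norm n \<le> cone_constant TYPE('a) * norm u"
    using cone_constant(2) by blast
  have "norm (T u) \<le> norm (T p) + norm (T n)"
    unfolding \<open>u = p - n\<close> linear_diff[OF \<open>linear T\<close>] by (rule norm_triangle_ineq4)
  also have "\<dots> \<le> norm p + norm n" using b pn by (intro add_mono)
  finally show ?thesis using pn by simp
qed

lemma linear_eq_on_cone:
  assumes "linear S" "linear T" and "\<And>u::'a::abstract_state_space. 0 \<le> u \<Longrightarrow> S u = T u"
  shows "S u = T u"
proof -
  obtain p n where "0 \<le> p" "0 \<le> n" "u = p - n"
    using positive_cone_generating by blast
  then show ?thesis by (simp add: assms linear_diff)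
qed

section \<open>The functional that extends the norm of the cone\<close>

lemma norm_differences_of_positive:
  fixes p n q m :: "'a::abstract_state_space"
  assumes "0 \<le> p" "0 \<le> n" "0 \<le> q" "0 \<le> m" "p - n = q - m"
  shows "norm p - norm n = norm q - norm m"
proof -
  have "p + m = q + n" using assms(5) by (simp add: algebra_simps)
  then have "norm (p + m) = norm (q + n)" by simp
  then show ?thesis using assms by (simp add: norm_additive)
qed

lemmas linear_blinfun_apply = bounded_linear.linear[OF blinfun.bounded_linear_right]

text \<open>The value at \<open>p - n\<close> has to be \<open>norm p - norm n\<close>. By
  additivity of the norm it does not depend on the decomposition, and the reverse triangle
  inequality bounds it by \<open>norm (p - n)\<close>.\<close>

lemma exists_Psi: "\<exists>f :: 'a::abstract_state_space dual. \<forall>u\<ge>0. f u = norm u"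
proof -
  define F where "F u = (THE r. \<exists>p n::'a. 0 \<le> p \<and> 0 \<le> n \<and> u = p - n \<and> r = norm p - norm n)" for u :: 'a
  have F: "F (p - n) = norm p - norm n" if "0 \<le> p" "0 \<le> n" for p n
    unfolding F_def
  proof (rule the_equality)
    show "\<exists>p' n'. 0 \<le> p' \<and> 0 \<le> n' \<and> p - n = p' - n' \<and> norm p - norm n = norm p' - norm n'"
      using that by blast
    fix r assume "\<exists>p' n'. 0 \<le> p' \<and> 0 \<le> n' \<and> p - n = p' - n' \<and> r = norm p' - norm n'"
    then show "r = norm p - norm n"
      using norm_differences_of_positive[OF that] by metis
  qed
  have "bounded_linear F"
  proof (rule bounded_linear_intro[where K = 1])
    fix x y :: 'a and r :: real
    obtain p n q m where x: "0 \<le> p" "0 \<le> n" "x = p - n" and y: "0 \<le> q" "0 \<le> m" "y = q - m"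
      using positive_cone_generating by metis
    have "x + y = (p + q) - (n + m)" using x y by simp
    then have "F (x + y) = norm (p + q) - norm (n + m)"
      using F[of "p + q" "n + m"] x(1,2) y(1,2) by (simp only: add_nonneg_nonneg)
    then show "F (x + y) = F x + F y"
      using x(1,2) y(1,2) F[OF x(1,2)] F[OF y(1,2)] unfolding x(3) y(3)
      by (simp add: norm_additive)
    show "F (r *\<^sub>R x) = r *\<^sub>R F x"
    proof (cases "0 \<le> r")
      case True
      have "r *\<^sub>R x = r *\<^sub>R p - r *\<^sub>R n"
        unfolding x(3) by (rule scaleR_diff_right)
      then have "F (r *\<^sub>R x) = norm (r *\<^sub>R p) - norm (r *\<^sub>R n)"
        using F[of "r *\<^sub>R p" "r *\<^sub>R n"] True x(1,2) by (simp only: scaleR_nonneg_nonneg)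
      also have "\<dots> = r * (norm p - norm n)"
        using True by (simp add: right_diff_distrib)
      finally show ?thesis unfolding x(3) F[OF x(1,2)] by simp
    next
      case False
      \<comment> \<open>A negative factor exchanges the two parts of the decomposition.\<close>
      have "r *\<^sub>R x = (- r) *\<^sub>R n - (- r) *\<^sub>R p"
        unfolding x(3) by (simp add: scaleR_diff_right)
      then have "F (r *\<^sub>R x) = norm ((- r) *\<^sub>R n) - norm ((- r) *\<^sub>R p)"
        using F[of "(- r) *\<^sub>R n" "(- r) *\<^sub>R p"] False x(1,2)
          scaleR_nonneg_nonneg[of "- r" n] scaleR_nonneg_nonneg[of "- r" p] by simp
      also have "\<dots> = r * (norm p - norm n)"
        using False by (simp add: right_diff_distrib)
      finally show ?thesis unfolding x(3) F[OF x(1,2)] by simp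
    qed
    show "norm (F x) \<le> norm x * 1"
      using norm_triangle_ineq3[of p n] unfolding x(3) F[OF x(1,2)] by simp
  qed
  moreover have "F u = norm u" if "0 \<le> u" for u using F[of u 0] that by simp
  ultimately show ?thesis
    by (intro exI[of _ "Blinfun F"]) (simp add: bounded_linear_Blinfun_apply)
qed

text \<open>Uniqueness, which gives the \<open>THE\<close> in \<open>Psi\<close> its meaning, holds
  because the cone generates the space.\<close>

lemma Psi_positive:
  assumes "0 \<le> (u::'a::abstract_state_space)"
  shows "Psi u = norm u"
proof -
  have "\<exists>!f :: 'a dual. \<forall>u\<ge>0. f u = norm u"
  proof (rule ex_ex1I[OF exists_Psi])
    fix f g :: "'a dual" assume "\<forall>u\<ge>0. f u = norm u" "\<forall>u\<ge>0. g u = norm u"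
    then show "f = g"
      using linear_eq_on_cone[of f g] by (simp add: blinfun_eqI linear_blinfun_apply)
  qed
  from theI'[OF this] assms show ?thesis by (simp add: Psi_def)
qed

lemma dual_cone_apply: "f \<in> dual_cone \<Longrightarrow> 0 \<le> u \<Longrightarrow> 0 \<le> blinfun_apply f u"
  by (simp add: dual_cone_def)

lemma Psi_in_dual_cone: "Psi \<in> dual_cone"
  by (simp add: dual_cone_def Psi_positive)

lemma dual_eq_0_on_cone:
  assumes "\<And>u. 0 \<le> u \<Longrightarrow> blinfun_apply f u = 0"
  shows "f = (0 :: 'a::abstract_state_space dual)"
proof (rule blinfun_eqI)
  fix u :: 'a
  show "f u = (0 :: 'a dual) u"
    using linear_eq_on_cone[of f "\<lambda>_. 0" u] assms
    by (simp add: linear_blinfun_apply module_hom_zero)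
qed

section \<open>Substochastic semigroups\<close>

lemma integral_shift_right:
  fixes f :: "real \<Rightarrow> 'a::banach"
  assumes "continuous_on {0..} f" "0 \<le> h"
  shows "integral {0..T} (\<lambda>s. f (h + s)) = integral {h..h + T} f"
proof -
  have "f integrable_on {h..h + T}"
    by (rule integrable_continuous_real, rule continuous_on_subset[OF assms(1)]) (use assms in auto)
  then have "((f \<circ> ((+) h)) has_integral integral {h..h + T} f) (cbox 0 T)"
    unfolding has_integral_shift_cbox_iff by (simp add: integrable_integral add.commute)
  then show ?thesis by (simp add: integral_unique o_def)
qed

text \<open>This is the fundamental theorem of calculus at the left end of
  \<open>{a..a + 1}\<close>, where the derivative is one-sided. Hence \<open>a = 0\<close> is
  allowed although \<open>f\<close> is controlled only on \<open>{0..}\<close>.\<close>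

lemma average_at_right:
  fixes f :: "real \<Rightarrow> 'a::banach"
  assumes "continuous_on {0..} f" "0 \<le> a"
  shows "((\<lambda>h. integral {a..a + h} f /\<^sub>R h) \<longlongrightarrow> f a) (at_right 0)"
proof -
  have "((\<lambda>x. integral {a..x} f) has_vector_derivative f a) (at a within {a..a + 1})"
    by (rule integral_has_vector_derivative, rule continuous_on_subset[OF assms(1)])
      (use assms(2) in auto)
  then have "((\<lambda>x. norm (integral {a..x} f - (x - a) *\<^sub>R f a) / norm (x - a)) \<longlongrightarrow> 0) (at_right a)"
    by (simp add: has_vector_derivative_def has_derivative_iff_norm at_within_Icc_at_right)
  then have "((\<lambda>x. norm (integral {a..x} f /\<^sub>R (x - a) - f a)) \<longlongrightarrow> 0) (at_right a)"
  proof (rule Lim_transform_eventually)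
    have "norm (integral {a..x} f - (x - a) *\<^sub>R f a) / norm (x - a)
        = norm (integral {a..x} f /\<^sub>R (x - a) - f a)" if "a < x" for x
    proof -
      have "integral {a..x} f /\<^sub>R (x - a) - f a = (integral {a..x} f - (x - a) *\<^sub>R f a) /\<^sub>R (x - a)"
        using that by (simp add: scaleR_diff_right)
      then show ?thesis using that by (simp add: divide_inverse)
    qed
    then show "\<forall>\<^sub>F x in at_right a. norm (integral {a..x} f - (x - a) *\<^sub>R f a) / norm (x - a)
        = norm (integral {a..x} f /\<^sub>R (x - a) - f a)"
      by (intro eventually_at_rightI[of a "a + 1"]) simp_all
  qed
  then have "((\<lambda>x. integral {a..x} f /\<^sub>R (x - a)) \<longlongrightarrow> f a) (at_right a)"
    by (rule LIM_zero_cancel[OF tendsto_norm_zero_cancel])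
  then have "((\<lambda>x. integral {a..x + a} f /\<^sub>R (x + a - a)) \<longlongrightarrow> f a) (at_right 0)"
    unfolding filterlim_at_right_to_0[of _ _ a] .
  then show ?thesis by (simp only: add_diff_cancel_right' add.commute)
qed

locale substochastic_semigroup_locale =
  fixes V :: "real \<Rightarrow> 'a::abstract_state_space \<Rightarrow>\<^sub>L 'a"
  assumes V: "substochastic_semigroup V"
begin

lemma V_0: "V 0 u = u"
  and V_add: "0 \<le> s \<Longrightarrow> 0 \<le> t \<Longrightarrow> V (s + t) u = V s (V t u)"
  and V_tendsto: "((\<lambda>t. V t u) \<longlongrightarrow> u) (at_right 0)"
  and V_positive: "0 \<le> t \<Longrightarrow> 0 \<le> u \<Longrightarrow> 0 \<le> V t u"
  and V_contractive: "0 \<le> t \<Longrightarrow> 0 \<le> u \<Longrightarrow> norm (V t u) \<le> norm u"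
proof -
  have c0: "c0_semigroup V" and sub: "\<And>t. 0 \<le> t \<Longrightarrow> substochastic (V t)"
    using V unfolding substochastic_semigroup_def by blast+
  show "V 0 u = u" using c0 unfolding c0_semigroup_def by simp
  show "((\<lambda>t. V t u) \<longlongrightarrow> u) (at_right 0)" using c0 unfolding c0_semigroup_def by blast
  show "V (s + t) u = V s (V t u)" if "0 \<le> s" "0 \<le> t"
  proof -
    have "V (s + t) = V s o\<^sub>L V t" using c0 that unfolding c0_semigroup_def by blast
    then show ?thesis by simp
  qed
  show "0 \<le> t \<Longrightarrow> 0 \<le> u \<Longrightarrow> 0 \<le> V t u" "0 \<le> t \<Longrightarrow> 0 \<le> u \<Longrightarrow> norm (V t u) \<le> norm u"
    using sub[of t] unfolding substochastic_def by blast+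
qed

lemma V_bound: "0 \<le> t \<Longrightarrow> norm (V t u) \<le> cone_constant TYPE('a) * norm u"
  by (rule linear_bounded_on_cone) (simp_all add: linear_blinfun_apply V_contractive)

lemma V_commute:
  assumes "0 \<le> s" "0 \<le> t"
  shows "V s (V t u) = V t (V s u)"
  using V_add[OF assms] V_add[OF assms(2,1)] add.commute[of s t] by metis

text \<open>The difference of two orbit values is \<open>V s (V h u - u)\<close> with
  \<open>s\<close> the earlier time. The bound on \<open>V s\<close> is uniform in \<open>s\<close>,
  so right continuity at 0 gives continuity from both sides.\<close>

lemma continuous_orbit: "continuous_on {0..} (\<lambda>t. V t u)"
proof (rule continuous_on_iff[THEN iffD2], intro ballI allI impI)
  fix t e :: real assume t: "t \<in> {0..}" and e: "0 < e"
  have C: "0 < cone_constant TYPE('a)" by (rule cone_constant)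
  obtain d where d: "0 < d" "\<And>h. 0 < h \<Longrightarrow> h < d \<Longrightarrow> norm (V h u - u) < e / cone_constant TYPE('a)"
    using tendstoD[OF V_tendsto[of u], of "e / cone_constant TYPE('a)"] e C
    by (auto simp: eventually_at_right_field dist_norm)
  have *: "norm (V (s + h) u - V s u) < e" if "0 \<le> s" "0 \<le> h" "h < d" for s h
  proof (cases "h = 0")
    case False
    have "V (s + h) u - V s u = V s (V h u - u)"
      using that by (simp add: V_add blinfun.diff_right)
    then have "norm (V (s + h) u - V s u) \<le> cone_constant TYPE('a) * norm (V h u - u)"
      using V_bound[OF that(1)] by simp
    also have "\<dots> < e" using d(2)[of h] False that C by (simp add: field_simps)
    finally show ?thesis .
  qed (use e in simp)
  have "dist (V s u) (V t u) < e" if s: "0 \<le> s" "dist s t < d" for s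
  proof (cases "s \<le> t")
    case True
    then show ?thesis
      using *[of s "t - s"] s t by (simp add: dist_norm norm_minus_commute)
  next
    case False
    then show ?thesis using *[of t "s - t"] s t by (simp add: dist_norm)
  qed
  then show "\<exists>d>0. \<forall>s\<in>{0..}. dist s t < d \<longrightarrow> dist (V s u) (V t u) < e"
    using d(1) by (intro exI[of _ d]) simp
qed

section \<open>The generator\<close>

abbreviation "D \<equiv> generator_dom V"
abbreviation "G \<equiv> generator V"

lemma generatorI:
  assumes "((\<lambda>t. (V t u - u) /\<^sub>R t) \<longlongrightarrow> v) (at_right 0)"
  shows "u \<in> D" "G u = v"
proof -
  show "u \<in> D" unfolding generator_dom_def using assms by blast
  show "G u = v" unfolding generator_def by (rule tendsto_Lim[OF _ assms]) simp
qed

lemma generatorD: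
  assumes "u \<in> D"
  shows "((\<lambda>t. (V t u - u) /\<^sub>R t) \<longlongrightarrow> G u) (at_right 0)"
proof -
  obtain v where "((\<lambda>t. (V t u - u) /\<^sub>R t) \<longlongrightarrow> v) (at_right 0)"
    using assms by (auto simp: generator_dom_def)
  with generatorI(2)[OF this] show ?thesis by simp
qed

text \<open>Applying \<open>V h\<close> shifts the interval of integration. The overlap cancels, and
  the difference quotient becomes an average over \<open>{t..t + h}\<close> minus one over
  \<open>{0..h}\<close>.\<close>

lemma generator_integral:
  assumes t: "0 \<le> t"
  shows "integral {0..t} (\<lambda>s. V s u) \<in> D" "G (integral {0..t} (\<lambda>s. V s u)) = V t u - u"
proof -
  let ?F = "\<lambda>T. integral {0..T} (\<lambda>s. V s u)"
  have i: "(\<lambda>s. V s u) integrable_on {a..b}" if "0 \<le> a" for a b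
    by (rule integrable_continuous_real, rule continuous_on_subset[OF continuous_orbit])
      (use that in auto)
  have "V h (?F t) - ?F t = integral {t..t + h} (\<lambda>s. V s u) - integral {0..0 + h} (\<lambda>s. V s u)"
    if h: "0 < h" for h
  proof -
    have "V h (?F t) = integral {0..t} (V h \<circ> (\<lambda>s. V s u))"
      by (rule integral_linear[symmetric]) (simp_all add: i blinfun.bounded_linear_right)
    also have "\<dots> = integral {0..t} (\<lambda>s. V (h + s) u)"
      by (rule integral_cong) (use h in \<open>simp add: V_add\<close>)
    also have "\<dots> = integral {h..h + t} (\<lambda>s. V s u)"
      using h by (intro integral_shift_right continuous_orbit) simp
    finally have "V h (?F t) = integral {h..t + h} (\<lambda>s. V s u)" by (simp add: add.commute)
    moreover have "integral {0..h} (\<lambda>s. V s u) + integral {h..t + h} (\<lambda>s. V s u) = ?F (t + h)"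
      using h t by (intro Henstock_Kurzweil_Integration.integral_combine i) auto
    moreover have "?F t + integral {t..t + h} (\<lambda>s. V s u) = ?F (t + h)"
      using h t by (intro Henstock_Kurzweil_Integration.integral_combine i) auto
    ultimately show ?thesis by (simp add: algebra_simps)
  qed
  then have ev: "\<forall>\<^sub>F h in at_right 0.
      integral {t..t + h} (\<lambda>s. V s u) /\<^sub>R h - integral {0..0 + h} (\<lambda>s. V s u) /\<^sub>R h
      = (V h (?F t) - ?F t) /\<^sub>R h"
    by (intro eventually_at_rightI[of 0 1]) (simp_all add: scaleR_diff_right)
  note lim = tendsto_diff[OF average_at_right[OF continuous_orbit[of u] t]
      average_at_right[OF continuous_orbit[of u] order_refl]]
  have "((\<lambda>h. (V h (?F t) - ?F t) /\<^sub>R h) \<longlongrightarrow> V t u - u) (at_right 0)"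
    using Lim_transform_eventually[OF lim ev] unfolding V_0 .
  from generatorI[OF this] show "?F t \<in> D" "G (?F t) = V t u - u" .
qed

lemma generator_scaleR:
  assumes "u \<in> D"
  shows "c *\<^sub>R u \<in> D" "G (c *\<^sub>R u) = c *\<^sub>R G u"
proof -
  have "((\<lambda>t. c *\<^sub>R ((V t u - u) /\<^sub>R t)) \<longlongrightarrow> c *\<^sub>R G u) (at_right 0)"
    by (intro tendsto_scaleR tendsto_const generatorD assms)
  moreover have "c *\<^sub>R ((V t u - u) /\<^sub>R t) = (V t (c *\<^sub>R u) - c *\<^sub>R u) /\<^sub>R t" for t
    unfolding blinfun.scaleR_right scaleR_diff_right[symmetric] by (rule scaleR_left_commute)
  ultimately have "((\<lambda>t. (V t (c *\<^sub>R u) - c *\<^sub>R u) /\<^sub>R t) \<longlongrightarrow> c *\<^sub>R G u) (at_right 0)"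
    by (simp only:)
  from generatorI[OF this] show "c *\<^sub>R u \<in> D" "G (c *\<^sub>R u) = c *\<^sub>R G u" .
qed

text \<open>Short averages of an orbit lie in \<open>D\<close> and converge to its starting
  point.\<close>

lemma generator_dom_dense: "closure D = UNIV"
proof -
  have "u \<in> closure D" for u
  proof (rule Lim_in_closed_set[OF closed_closure])
    show "((\<lambda>h. integral {0..0 + h} (\<lambda>s. V s u) /\<^sub>R h) \<longlongrightarrow> u) (at_right 0)"
      using average_at_right[OF continuous_orbit[of u] order_refl] by (simp add: V_0)
    have "integral {0..0 + h} (\<lambda>s. V s u) /\<^sub>R h \<in> D" if "0 < h" for h
      using generator_scaleR(1)[OF generator_integral(1)[of "0 + h" u]] that by simp
    then show "\<forall>\<^sub>F h in at_right 0. integral {0..0 + h} (\<lambda>s. V s u) /\<^sub>R h \<in> closure D"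
      by (intro eventually_at_rightI[of 0 1] subsetD[OF closure_subset]) simp_all
  qed simp
  then show ?thesis by blast
qed

section \<open>The resolvent as a Laplace transform\<close>

definition laplace_upto :: "real \<Rightarrow> 'a \<Rightarrow> real \<Rightarrow> 'a" where
  "laplace_upto lam u T = integral {0..T} (\<lambda>s. exp (- lam * s) *\<^sub>R V s u)"

text \<open>The improper integral over the half line, encoded as a series over unit intervals: its
  terms have a geometric majorant, so convergence is that of an absolutely convergent
  series.\<close>

definition laplace :: "real \<Rightarrow> 'a \<Rightarrow> 'a" where
  "laplace lam u = (\<Sum>n. laplace_upto lam u (Suc n) - laplace_upto lam u n)"

lemma continuous_laplace_integrand: "continuous_on {0..} (\<lambda>s. exp (- lam * s) *\<^sub>R V s u)"
  by (rule continuous_on_scaleR[OF _ continuous_orbit]) (rule continuous_intros)+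

lemma laplace_integrable: "0 \<le> a \<Longrightarrow> (\<lambda>s. exp (- lam * s) *\<^sub>R V s u) integrable_on {a..b}"
  by (rule integrable_continuous_real, rule continuous_on_subset[OF continuous_laplace_integrand])
    auto

lemma laplace_upto_split:
  assumes "0 \<le> S" "0 \<le> h"
  shows "laplace_upto lam u (S + h) =
    laplace_upto lam u S + integral {S..S + h} (\<lambda>s. exp (- lam * s) *\<^sub>R V s u)"
  unfolding laplace_upto_def
  by (rule Henstock_Kurzweil_Integration.integral_combine[symmetric])
    (use assms laplace_integrable[OF order_refl] in simp_all)

lemma laplace_upto_increment:
  assumes "0 < lam" "0 \<le> S" "0 \<le> h"
  shows "norm (laplace_upto lam u (S + h) - laplace_upto lam u S)
    \<le> cone_constant TYPE('a) * norm u * exp (- lam * S) * h"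
proof -
  have C: "0 < cone_constant TYPE('a)" by (rule cone_constant)
  have "norm (integral {S..S + h} (\<lambda>s. exp (- lam * s) *\<^sub>R V s u))
      \<le> (cone_constant TYPE('a) * norm u * exp (- lam * S)) * (S + h - S)"
  proof (rule integral_bound)
    show "continuous_on {S..S + h} (\<lambda>s. exp (- lam * s) *\<^sub>R V s u)"
      by (rule continuous_on_subset[OF continuous_laplace_integrand]) (use assms in auto)
    fix s assume s: "s \<in> {S..S + h}"
    have "exp (- lam * s) * norm (V s u) \<le> exp (- lam * S) * (cone_constant TYPE('a) * norm u)"
      by (rule mult_mono) (use assms s V_bound[of s u] C in auto)
    then show "norm (exp (- lam * s) *\<^sub>R V s u) \<le> cone_constant TYPE('a) * norm u * exp (- lam * S)"
      by (simp add: mult_ac)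
  qed (use assms in simp)
  then show ?thesis using assms by (simp add: laplace_upto_split)
qed

lemma laplace_sums:
  assumes "0 < lam"
  shows "(\<lambda>n. laplace_upto lam u (Suc n) - laplace_upto lam u n) sums laplace lam u"
    and "norm (laplace lam u) \<le> cone_constant TYPE('a) / (1 - exp (- lam)) * norm u"
proof -
  have b: "norm (laplace_upto lam u (Suc n) - laplace_upto lam u n)
      \<le> (cone_constant TYPE('a) * norm u) * exp (- lam) ^ n" for n
    using laplace_upto_increment[OF assms, of n 1 u]
    by (simp add: exp_of_nat_mult[symmetric] add.commute mult_ac)
  have g: "(\<lambda>n. (cone_constant TYPE('a) * norm u) * exp (- lam) ^ n) sums
      ((cone_constant TYPE('a) * norm u) * (1 / (1 - exp (- lam))))"
    by (rule sums_mult[OF geometric_sums]) (use assms in simp)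
  show "(\<lambda>n. laplace_upto lam u (Suc n) - laplace_upto lam u n) sums laplace lam u"
    unfolding laplace_def
    by (rule summable_sums, rule summable_comparison_test'[OF sums_summable[OF g], of 0]) (rule b)
  show "norm (laplace lam u) \<le> cone_constant TYPE('a) / (1 - exp (- lam)) * norm u"
    using norm_suminf_le[OF b sums_summable[OF g]] sums_unique[OF g]
    by (simp add: laplace_def)
qed

lemma laplace_limit:
  assumes "0 < lam"
  shows "(\<lambda>n. laplace_upto lam u (real n)) \<longlonglongrightarrow> laplace lam u"
proof -
  have "laplace_upto lam u 0 = 0" by (simp add: laplace_upto_def)
  then have "(\<Sum>k<n. laplace_upto lam u (Suc k) - laplace_upto lam u k) = laplace_upto lam u n" for n
    using sum_lessThan_telescope[of "\<lambda>n. laplace_upto lam u (real n)" n] by simp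
  then show ?thesis using laplace_sums(1)[OF assms, of u] by (simp add: sums_def)
qed

text \<open>Needed because \<open>V h\<close> moves the upper limit of integration from
  \<open>n\<close> to \<open>n + h\<close>, off the integers.\<close>

lemma laplace_limit_shifted:
  assumes "0 < lam" "0 \<le> h"
  shows "(\<lambda>n. laplace_upto lam u (real n + h)) \<longlonglongrightarrow> laplace lam u"
proof -
  have "(\<lambda>n. cone_constant TYPE('a) * norm u * exp (- lam) ^ n * h) \<longlonglongrightarrow>
      cone_constant TYPE('a) * norm u * 0 * h"
    by (intro tendsto_intros LIMSEQ_power_zero) (use assms in simp)
  then have lim: "(\<lambda>n. cone_constant TYPE('a) * norm u * exp (- lam) ^ n * h) \<longlonglongrightarrow> 0" by simp
  have "norm (laplace_upto lam u (real n + h) - laplace_upto lam u n)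
      \<le> cone_constant TYPE('a) * norm u * exp (- lam) ^ n * h" for n
    using laplace_upto_increment[OF assms(1) _ assms(2), of n u]
    by (simp add: exp_of_nat_mult[symmetric] mult_ac)
  then have "(\<lambda>n. laplace_upto lam u (real n + h) - laplace_upto lam u n) \<longlonglongrightarrow> 0"
    by (intro Lim_null_comparison[OF always_eventually lim] allI)
  from tendsto_add[OF this laplace_limit[OF assms(1), of u]] show ?thesis by simp
qed

lemma linear_laplace:
  assumes "0 < lam"
  shows "linear (laplace lam)"
proof (rule linearI)
  fix u v :: 'a and c :: real
  have "laplace_upto lam (u + v) T = laplace_upto lam u T + laplace_upto lam v T" for T
    unfolding laplace_upto_def
    by (subst integral_add[symmetric])
      (simp_all add: laplace_integrable[simplified] blinfun.add_right scaleR_add_right)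
  then have "(\<lambda>n. laplace_upto lam (u + v) (real n)) \<longlonglongrightarrow> laplace lam u + laplace lam v"
    using tendsto_add[OF laplace_limit[OF assms, of u] laplace_limit[OF assms, of v]] by simp
  with laplace_limit[OF assms] show "laplace lam (u + v) = laplace lam u + laplace lam v"
    by (rule LIMSEQ_unique)
  have "laplace_upto lam (c *\<^sub>R u) T = c *\<^sub>R laplace_upto lam u T" for T
    unfolding laplace_upto_def integral_cmul[symmetric]
    by (simp add: blinfun.scaleR_right mult.commute)
  then have "(\<lambda>n. laplace_upto lam (c *\<^sub>R u) (real n)) \<longlonglongrightarrow> c *\<^sub>R laplace lam u"
    using tendsto_scaleR[OF tendsto_const laplace_limit[OF assms, of u]] by simp
  with laplace_limit[OF assms] show "laplace lam (c *\<^sub>R u) = c *\<^sub>R laplace lam u"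
    by (rule LIMSEQ_unique)
qed

lemma bounded_linear_laplace:
  assumes "0 < lam"
  shows "bounded_linear (laplace lam)"
proof (rule bounded_linear_intro)
  show "norm (laplace lam u) \<le> norm u * (cone_constant TYPE('a) / (1 - exp (- lam)))" for u
    using laplace_sums(2)[OF assms, of u] by (simp only: mult.commute)
qed (simp_all add: linear_add linear_scale linear_laplace[OF assms])

lemma laplace_positive:
  assumes "0 < lam" "0 \<le> u"
  shows "0 \<le> laplace lam u"
proof (rule positive_limit[OF laplace_limit[OF assms(1)]])
  have "0 \<le> laplace_upto lam u (real n)" for n
    unfolding laplace_upto_def
    by (intro positive_integral laplace_integrable scaleR_nonneg_nonneg)
      (auto simp: V_positive assms)
  then show "\<forall>\<^sub>F n in sequentially. 0 \<le> laplace_upto lam u (real n)" by simp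
qed simp

text \<open>Taken under the integral, \<open>V h\<close> either advances the time, which after a
  substitution gives the first formula, or commutes with \<open>V s\<close>, which gives the second.
  The first yields the generator on the range of \<open>laplace\<close>, the second shows that
  \<open>laplace\<close> commutes with the generator.\<close>

lemma V_laplace:
  assumes "0 < lam" "0 \<le> h"
  shows "V h (laplace lam u) = exp (lam * h) *\<^sub>R (laplace lam u - laplace_upto lam u h)"
    and "V h (laplace lam u) = laplace lam (V h u)"
proof -
  have 1: "V h (laplace_upto lam u T) =
      integral {0..T} (\<lambda>s. exp (- lam * s) *\<^sub>R V h (V s u))" for T
    unfolding laplace_upto_def
    using integral_linear[OF laplace_integrable[OF order_refl] blinfun.bounded_linear_right[of "V h"]]
    by (simp add: o_def blinfun.scaleR_right)
  have 2: "V h (laplace_upto lam u T) = laplace_upto lam (V h u) T" for T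
    unfolding 1 unfolding laplace_upto_def
    by (rule integral_cong) (use assms in \<open>simp add: V_commute[of h]\<close>)
  have 3: "V h (laplace_upto lam u T) =
      exp (lam * h) *\<^sub>R (laplace_upto lam u (T + h) - laplace_upto lam u h)" if T: "0 \<le> T" for T
  proof -
    have "V h (laplace_upto lam u T) =
        integral {0..T} (\<lambda>s. exp (lam * h) *\<^sub>R (exp (- lam * (h + s)) *\<^sub>R V (h + s) u))"
      unfolding 1
    proof (rule integral_cong)
      fix s assume "s \<in> {0..T}"
      then show "exp (- lam * s) *\<^sub>R V h (V s u) =
          exp (lam * h) *\<^sub>R (exp (- lam * (h + s)) *\<^sub>R V (h + s) u)"
        using assms by (simp add: V_add exp_add[symmetric] algebra_simps)
    qed
    also have "\<dots> = exp (lam * h) *\<^sub>R integral {h..h + T} (\<lambda>s. exp (- lam * s) *\<^sub>R V s u)"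
      unfolding integral_cmul integral_shift_right[OF continuous_laplace_integrand assms(2)] ..
    also have "integral {h..h + T} (\<lambda>s. exp (- lam * s) *\<^sub>R V s u) =
        laplace_upto lam u (T + h) - laplace_upto lam u h"
      using laplace_upto_split[OF assms(2) T] by (simp add: add.commute)
    finally show ?thesis .
  qed
  have lim: "(\<lambda>n. V h (laplace_upto lam u (real n))) \<longlonglongrightarrow> V h (laplace lam u)"
    by (intro blinfun.tendsto tendsto_const laplace_limit assms)
  have "(\<lambda>n. V h (laplace_upto lam u (real n))) \<longlonglongrightarrow>
      exp (lam * h) *\<^sub>R (laplace lam u - laplace_upto lam u h)"
    using tendsto_scaleR[OF tendsto_const
      tendsto_diff[OF laplace_limit_shifted[OF assms, of u] tendsto_const]]
    by (simp add: 3)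
  with lim show "V h (laplace lam u) = exp (lam * h) *\<^sub>R (laplace lam u - laplace_upto lam u h)"
    by (rule LIMSEQ_unique)
  show "V h (laplace lam u) = laplace lam (V h u)"
    by (rule LIMSEQ_unique[OF lim]) (simp add: 2 laplace_limit assms)
qed

text \<open>By \<open>V_laplace(1)\<close> the difference quotient is
  \<open>(exp (lam * h) - 1) / h\<close> times \<open>laplace lam u\<close>, minus
  \<open>exp (lam * h)\<close> times the average of the integrand over \<open>{0..h}\<close>. Both
  limits are known.\<close>

lemma generator_laplace:
  assumes "0 < lam"
  shows "laplace lam u \<in> D" "G (laplace lam u) = lam *\<^sub>R laplace lam u - u"
proof -
  let ?v = "laplace lam u"
  have e: "((\<lambda>h. (exp (lam * h) - 1) / h) \<longlongrightarrow> lam) (at_right 0)"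
  proof -
    have "((\<lambda>h. exp (lam * h)) has_real_derivative lam) (at 0)"
      by (auto intro!: derivative_eq_intros)
    then have "((\<lambda>h. (exp (lam * h) - 1) / h) \<longlongrightarrow> lam) (at 0)"
      by (simp add: DERIV_def)
    then show ?thesis by (rule filterlim_at_split[THEN iffD1, THEN conjunct2])
  qed
  have c: "((\<lambda>h. exp (lam * h)) \<longlongrightarrow> exp (lam * 0)) (at_right 0)"
    by (intro tendsto_intros)
  have a: "((\<lambda>h. integral {0..0 + h} (\<lambda>s. exp (- lam * s) *\<^sub>R V s u) /\<^sub>R h) \<longlongrightarrow> u) (at_right 0)"
    using average_at_right[OF continuous_laplace_integrand order_refl, of lam u] by (simp add: V_0)
  have lim: "((\<lambda>h. ((exp (lam * h) - 1) / h) *\<^sub>R ?v - exp (lam * h) *\<^sub>R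
      (integral {0..0 + h} (\<lambda>s. exp (- lam * s) *\<^sub>R V s u) /\<^sub>R h)) \<longlongrightarrow>
      lam *\<^sub>R ?v - exp (lam * 0) *\<^sub>R u) (at_right 0)"
    by (intro tendsto_diff tendsto_scaleR e c a tendsto_const)
  have ev: "\<forall>\<^sub>F h in at_right 0. ((exp (lam * h) - 1) / h) *\<^sub>R ?v - exp (lam * h) *\<^sub>R
      (integral {0..0 + h} (\<lambda>s. exp (- lam * s) *\<^sub>R V s u) /\<^sub>R h) = (V h ?v - ?v) /\<^sub>R h"
    by (rule eventually_at_rightI[of 0 1])
      (use assms in \<open>simp_all add: V_laplace(1) laplace_upto_def algebra_simps divide_inverse\<close>)
  have "((\<lambda>h. (V h ?v - ?v) /\<^sub>R h) \<longlongrightarrow> lam *\<^sub>R ?v - u) (at_right 0)"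
    using Lim_transform_eventually[OF lim ev] by simp
  from generatorI[OF this] show "?v \<in> D" "G ?v = lam *\<^sub>R ?v - u" .
qed

text \<open>A bounded operator that commutes with every \<open>V h\<close> commutes with
  \<open>G\<close> on \<open>D\<close>, so the right inverse of \<open>lam - G\<close> just found is
  also a left inverse.\<close>

lemma laplace_generator:
  assumes "0 < lam" "u \<in> D"
  shows "laplace lam (lam *\<^sub>R u - G u) = u"
proof -
  interpret bounded_linear "laplace lam" by (rule bounded_linear_laplace[OF assms(1)])
  have lim: "((\<lambda>h. laplace lam ((V h u - u) /\<^sub>R h)) \<longlongrightarrow> laplace lam (G u)) (at_right 0)"
    by (intro tendsto generatorD assms)
  have ev: "\<forall>\<^sub>F h in at_right 0. laplace lam ((V h u - u) /\<^sub>R h)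
      = (V h (laplace lam u) - laplace lam u) /\<^sub>R h"
    by (rule eventually_at_rightI[of 0 1])
      (use assms in \<open>simp_all add: V_laplace(2) scaleR diff\<close>)
  have "G (laplace lam u) = laplace lam (G u)"
    by (rule generatorI(2)[OF Lim_transform_eventually[OF lim ev]])
  then show ?thesis
    unfolding generator_laplace(2)[OF assms(1), of u] diff scaleR by (metis diff_diff_eq2 add_diff_cancel_left')
qed

lemma resolvent_eq_laplace:
  assumes "0 < lam"
  shows "resolvent D G lam u = laplace lam u"
  unfolding resolvent_def
proof (rule the_equality)
  show "laplace lam u \<in> D \<and> lam *\<^sub>R laplace lam u - G (laplace lam u) = u"
    using generator_laplace[OF assms] by simp
next
  fix v assume "v \<in> D \<and> lam *\<^sub>R v - G v = u"
  then show "v = laplace lam u" using laplace_generator[OF assms, of v] by simp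
qed

text \<open>These facts are applied to two semigroups: the one generated by \<open>A\<close> and the
  Kato semigroup.\<close>

lemma resolvent_generator:
  assumes "0 < lam"
  shows "resolvent D G lam u \<in> D"
    and "lam *\<^sub>R resolvent D G lam u - G (resolvent D G lam u) = u"
    and "v \<in> D \<Longrightarrow> resolvent D G lam (lam *\<^sub>R v - G v) = v"
    and "linear (resolvent D G lam)"
    and "0 \<le> u \<Longrightarrow> 0 \<le> resolvent D G lam u"
proof -
  have "resolvent D G lam = laplace lam" using resolvent_eq_laplace[OF assms] by blast
  then show "resolvent D G lam u \<in> D"
    "lam *\<^sub>R resolvent D G lam u - G (resolvent D G lam u) = u"
    "v \<in> D \<Longrightarrow> resolvent D G lam (lam *\<^sub>R v - G v) = v" "linear (resolvent D G lam)"
    "0 \<le> u \<Longrightarrow> 0 \<le> resolvent D G lam u"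
    using assms
    by (simp_all add: generator_laplace laplace_generator linear_laplace laplace_positive)
qed

end

section \<open>Adjoints\<close>

text \<open>Two candidates for the adjoint agree on a closed set containing the dense set
  \<open>D\<close>.\<close>

lemma adjoint_op_eq:
  assumes dense: "closure D = UNIV" and g: "\<And>u. u \<in> D \<Longrightarrow> blinfun_apply f (T u) = blinfun_apply g u"
  shows "adjoint_op D T f = g"
  unfolding adjoint_op_def
proof (rule the_equality)
  show "\<forall>u\<in>D. blinfun_apply f (T u) = blinfun_apply g u" using g by blast
  fix h assume "\<forall>u\<in>D. blinfun_apply f (T u) = blinfun_apply h u"
  then have "D \<subseteq> {u. blinfun_apply h u = blinfun_apply g u}" using g by auto
  moreover have "closed {u. blinfun_apply h u = blinfun_apply g u}"
    by (intro closed_Collect_eq blinfun.continuous_on continuous_on_const continuous_on_id)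
  ultimately have "closure D \<subseteq> {u. blinfun_apply h u = blinfun_apply g u}"
    by (rule closure_minimal)
  then show "h = g" unfolding dense by (intro blinfun_eqI) auto
qed

lemma adjoint_op_bounded_linear:
  assumes "bounded_linear T"
  shows "adjoint_op UNIV T f u = f (T u)"
proof -
  have "bounded_linear (\<lambda>u. f (T u))"
    using bounded_linear_compose[OF blinfun.bounded_linear_right assms] .
  note b = bounded_linear_Blinfun_apply[OF this]
  have "adjoint_op UNIV T f = Blinfun (\<lambda>u. f (T u))"
    by (rule adjoint_op_eq) (simp_all add: b)
  then show ?thesis by (simp add: b)
qed

lemma adjoint_op_funpow:
  assumes "bounded_linear T"
  shows "(adjoint_op UNIV T ^^ n) f u = f ((T ^^ n) u)"
proof (induction n arbitrary: u)
  case (Suc n)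
  have "(adjoint_op UNIV T ^^ Suc n) f u = (adjoint_op UNIV T ^^ n) f (T u)"
    by (simp add: adjoint_op_bounded_linear[OF assms])
  then show ?case by (simp add: Suc funpow_swap1[of T])
qed simp

section \<open>The limit functional and honesty\<close>

locale kato_locale =
  fixes DA DB :: "'a::abstract_state_space set"
    and A B :: "'a \<Rightarrow> 'a"
    and V :: "real \<Rightarrow> 'a \<Rightarrow>\<^sub>L 'a"
  assumes kato: "kato_conditions DA A DB B"
    and kato_sg: "kato_semigroup DA A B V"
begin

sublocale V: substochastic_semigroup_locale V
  using kato_sg by unfold_locales (simp add: kato_semigroup_def)

abbreviation "R \<equiv> resolvent DA A"
abbreviation "K \<equiv> BR DA A B"
abbreviation "RG \<equiv> resolvent (generator_dom V) (generator V)"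
abbreviation "G \<equiv> generator V"

section \<open>Kato's conditions and the operator \<open>K\<close>\<close>

lemma subspace_DA: "subspace DA"
  and A_add: "u \<in> DA \<Longrightarrow> v \<in> DA \<Longrightarrow> A (u + v) = A u + A v"
  and B_add: "u \<in> DA \<Longrightarrow> v \<in> DA \<Longrightarrow> B (u + v) = B u + B v"
  and B_scaleR: "u \<in> DA \<Longrightarrow> B (c *\<^sub>R u) = c *\<^sub>R B u"
  and B_positive: "u \<in> DA \<Longrightarrow> 0 \<le> u \<Longrightarrow> 0 \<le> B u"
  and Psi_AB: "u \<in> DA \<Longrightarrow> 0 \<le> u \<Longrightarrow> Psi (A u + B u) \<le> 0"
proof -
  have A: "linear_operator DA A" and B: "linear_operator DB B" and sub: "DA \<subseteq> DB"
    and pos: "\<forall>u\<in>DA. 0 \<le> u \<longrightarrow> 0 \<le> B u"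
    and neg: "\<forall>u\<in>DA. 0 \<le> u \<longrightarrow> Psi (A u + B u) \<le> 0"
    using kato unfolding kato_conditions_def by simp_all
  show "subspace DA" "u \<in> DA \<Longrightarrow> v \<in> DA \<Longrightarrow> A (u + v) = A u + A v"
    using A by (simp_all add: linear_operator_def)
  show "u \<in> DA \<Longrightarrow> v \<in> DA \<Longrightarrow> B (u + v) = B u + B v" "u \<in> DA \<Longrightarrow> B (c *\<^sub>R u) = c *\<^sub>R B u"
    using B subsetD[OF sub] by (simp_all add: linear_operator_def)
  show "u \<in> DA \<Longrightarrow> 0 \<le> u \<Longrightarrow> 0 \<le> B u" "u \<in> DA \<Longrightarrow> 0 \<le> u \<Longrightarrow> Psi (A u + B u) \<le> 0"
    using pos neg by simp_all
qed

lemma resolvent_A: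
  assumes "0 < lam"
  shows R_in_DA: "R lam u \<in> DA"
    and A_R: "A (R lam u) = lam *\<^sub>R R lam u - u"
    and R_left: "v \<in> DA \<Longrightarrow> R lam (lam *\<^sub>R v - A v) = v"
    and linear_R: "linear (R lam)"
    and R_positive: "0 \<le> u \<Longrightarrow> 0 \<le> R lam u"
proof -
  have "generates_substochastic DA A"
    using kato unfolding kato_conditions_def by simp
  then obtain U where U: "substochastic_semigroup U" "DA = generator_dom U"
      "\<forall>u\<in>DA. A u = generator U u"
    unfolding generates_substochastic_def by (elim exE conjE)
  interpret U: substochastic_semigroup_locale U by unfold_locales (rule U(1))
  \<comment> \<open>\<open>A\<close> and \<open>generator U\<close> agree only on \<open>DA\<close>,
    so the resolvents are matched through the condition that defines them.\<close>
  have "(v \<in> DA \<and> lam *\<^sub>R v - A v = u) \<longleftrightarrow>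
      (v \<in> generator_dom U \<and> lam *\<^sub>R v - generator U v = u)" for u v
    using U(3) unfolding U(2) by auto
  then have R: "R lam = resolvent (generator_dom U) (generator U) lam"
    unfolding resolvent_def by (intro ext) simp
  note r = U.resolvent_generator[OF assms, folded R, folded U(2)]
  show "R lam u \<in> DA" by (rule r(1))
  show "A (R lam u) = lam *\<^sub>R R lam u - u"
    using r(2)[of u] U(3) \<open>R lam u \<in> DA\<close> by (simp add: algebra_simps)
  show "v \<in> DA \<Longrightarrow> R lam (lam *\<^sub>R v - A v) = v" using r(3)[of v] U(3) by simp
  show "linear (R lam)" by (rule r(4))
  show "0 \<le> u \<Longrightarrow> 0 \<le> R lam u" by (rule r(5))
qed

lemma dense_DA: "closure DA = UNIV"
proof -
  have "generates_substochastic DA A"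
    using kato unfolding kato_conditions_def by simp
  then obtain U where "substochastic_semigroup U" and DA: "DA = generator_dom U"
    unfolding generates_substochastic_def by (elim exE conjE)
  then interpret U: substochastic_semigroup_locale U by unfold_locales
  show ?thesis unfolding DA by (rule U.generator_dom_dense)
qed

lemma K_eq: "K lam u = B (R lam u)"
  by (simp add: BR_def)

lemma linear_K:
  assumes "0 < lam"
  shows "linear (K lam)"
  using R_in_DA[OF assms]
  by (intro linearI) (simp_all add: K_eq B_add B_scaleR linear_add[OF linear_R] linear_scale[OF linear_R] assms)

lemma K_positive: "0 < lam \<Longrightarrow> 0 \<le> u \<Longrightarrow> 0 \<le> K lam u"
  by (simp add: K_eq B_positive R_in_DA R_positive)

text \<open>Since \<open>A R = lam R - 1\<close>, one has \<open>K = 1 + (A + B) R - lam R\<close>.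
  This identity carries statements about \<open>A + B\<close> over to \<open>K\<close> and
  back.\<close>

lemma dual_K:
  assumes "0 < lam"
  shows "blinfun_apply f (K lam u) = f u + (f (A (R lam u) + B (R lam u)) - lam * f (R lam u))"
  by (simp add: K_eq A_R assms blinfun.add_right blinfun.diff_right blinfun.scaleR_right)

text \<open>In \<open>dual_K\<close> with \<open>f = Psi\<close> both correction terms are at most
  0, the first by Kato's third condition.\<close>

lemma norm_K:
  assumes lam: "0 < lam" and u: "0 \<le> u"
  shows "norm (K lam u) \<le> norm u"
proof -
  have "Psi (A (R lam u) + B (R lam u)) \<le> 0"
    using assms by (intro Psi_AB R_in_DA R_positive)
  moreover have "0 \<le> lam * Psi (R lam u)"
    using assms dual_cone_apply[OF Psi_in_dual_cone R_positive[OF lam u]] by simp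
  ultimately show ?thesis
    using dual_K[OF lam, of Psi u] assms by (simp add: Psi_positive K_positive)
qed

lemma bounded_linear_K:
  assumes "0 < lam"
  shows "bounded_linear (K lam)"
proof (rule bounded_linear_intro)
  show "norm (K lam u) \<le> norm u * cone_constant TYPE('a)" for u
    using linear_bounded_on_cone[OF linear_K[OF assms] norm_K[OF assms], of u]
    by (simp only: mult.commute)
qed (simp_all add: linear_add linear_scale linear_K[OF assms])

section \<open>Powers of \<open>K\<close> and the limit functional\<close>

lemma linear_K_funpow: "0 < lam \<Longrightarrow> linear (K lam ^^ n)"
  by (induction n) (simp_all add: linear_compose linear_K linear_id)

lemma K_funpow:
  assumes "0 < lam" "0 \<le> u"
  shows K_funpow_positive: "0 \<le> (K lam ^^ n) u"
    and norm_K_funpow_Suc: "norm ((K lam ^^ Suc n) u) \<le> norm ((K lam ^^ n) u)"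
    and norm_K_funpow: "norm ((K lam ^^ n) u) \<le> norm u"
proof -
  show pos: "0 \<le> (K lam ^^ n) u" for n
    by (induction n) (simp_all add: assms K_positive)
  show dec: "norm ((K lam ^^ Suc n) u) \<le> norm ((K lam ^^ n) u)" for n
    by (simp add: norm_K[OF assms(1) pos])
  show "norm ((K lam ^^ n) u) \<le> norm u"
    by (induction n) (use dec order_trans in auto)
qed

text \<open>The weak* limit of the iterates of \<open>Psi\<close> under the adjoint of
  \<open>K lam\<close>. That the pointwise limit exists and is bounded and linear, as
  \<open>Blinfun\<close> requires, is proved in the next two lemmas.\<close>

definition limit_functional :: "real \<Rightarrow> 'a dual" where
  "limit_functional lam = Blinfun (\<lambda>u. lim (\<lambda>n. Psi ((K lam ^^ n) u)))"

abbreviation "L \<equiv> limit_functional"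

text \<open>On the cone these numbers are norms and decrease; any other vector is a difference of
  positive ones.\<close>

lemma Psi_K_funpow_convergent:
  assumes "0 < lam"
  shows "convergent (\<lambda>n. Psi ((K lam ^^ n) u))"
proof -
  have pos: "convergent (\<lambda>n. Psi ((K lam ^^ n) u))" if "0 \<le> u" for u
  proof -
    have "decseq (\<lambda>n. norm ((K lam ^^ n) u))"
      by (rule decseq_SucI) (rule norm_K_funpow_Suc[OF assms that])
    then obtain l where "(\<lambda>n. norm ((K lam ^^ n) u)) \<longlonglongrightarrow> l"
      by (rule decseq_convergent[where B = 0]) auto
    then have "convergent (\<lambda>n. norm ((K lam ^^ n) u))" by (rule convergentI)
    then show ?thesis by (simp add: Psi_positive K_funpow_positive assms that)
  qed
  obtain p n where "0 \<le> p" "0 \<le> n" "u = p - n"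
    using positive_cone_generating by blast
  then show ?thesis
    using convergent_diff[OF pos pos]
    by (simp add: linear_diff[OF linear_K_funpow] assms blinfun.diff_right)
qed

lemma limit_functional_apply:
  assumes lam: "0 < lam"
  shows limit_functional_tendsto: "(\<lambda>n. Psi ((K lam ^^ n) u)) \<longlonglongrightarrow> L lam u"
    and limit_functional_bounds: "0 \<le> u \<Longrightarrow> 0 \<le> L lam u" "0 \<le> u \<Longrightarrow> L lam u \<le> norm u"
proof -
  define l where "l u = lim (\<lambda>n. Psi ((K lam ^^ n) u))" for u
  have l: "(\<lambda>n. Psi ((K lam ^^ n) u)) \<longlonglongrightarrow> l u" for u
    unfolding l_def using Psi_K_funpow_convergent[OF lam] by (simp add: convergent_LIMSEQ_iff)
  have "linear l"
  proof (rule linearI)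
    fix u v :: 'a and c :: real
    have "(\<lambda>n. Psi ((K lam ^^ n) (u + v))) \<longlonglongrightarrow> l u + l v"
      using tendsto_add[OF l[of u] l[of v]]
      by (simp add: linear_add[OF linear_K_funpow] lam blinfun.add_right)
    with l show "l (u + v) = l u + l v" by (rule LIMSEQ_unique)
    have "(\<lambda>n. Psi ((K lam ^^ n) (c *\<^sub>R u))) \<longlonglongrightarrow> c *\<^sub>R l u"
      using tendsto_scaleR[OF tendsto_const[of c] l[of u]]
      by (simp add: linear_scale[OF linear_K_funpow] lam blinfun.scaleR_right)
    with l show "l (c *\<^sub>R u) = c *\<^sub>R l u" by (rule LIMSEQ_unique)
  qed
  have pos: "0 \<le> l u" if "0 \<le> u" for u
    by (rule LIMSEQ_le_const[OF l[of u]])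
      (simp add: Psi_positive K_funpow_positive lam that)
  have le: "l u \<le> norm u" if "0 \<le> u" for u
    by (rule LIMSEQ_le_const2[OF l[of u]])
      (simp add: Psi_positive K_funpow_positive norm_K_funpow lam that)
  have "bounded_linear l"
  proof (rule bounded_linear_intro)
    have "norm (l u) \<le> norm u" if "0 \<le> u" for u
      using pos[OF that] le[OF that] by simp
    from linear_bounded_on_cone[OF \<open>linear l\<close> this]
    show "norm (l u) \<le> norm u * cone_constant TYPE('a)" for u
      by (simp only: mult.commute)
  qed (simp_all add: linear_add linear_scale \<open>linear l\<close>)
  then have L: "blinfun_apply (L lam) = l"
    unfolding limit_functional_def l_def by (simp add: bounded_linear_Blinfun_apply)
  show "(\<lambda>n. Psi ((K lam ^^ n) u)) \<longlonglongrightarrow> L lam u" unfolding L by (rule l)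
  show "0 \<le> u \<Longrightarrow> 0 \<le> L lam u" "0 \<le> u \<Longrightarrow> L lam u \<le> norm u"
    unfolding L using pos le by blast+
qed

lemma limit_functional_K:
  assumes "0 < lam"
  shows "L lam (K lam u) = L lam u"
proof (rule LIMSEQ_unique)
  show "(\<lambda>n. Psi ((K lam ^^ Suc n) u)) \<longlonglongrightarrow> L lam u"
    using LIMSEQ_Suc[OF limit_functional_tendsto[OF assms]] .
  show "(\<lambda>n. Psi ((K lam ^^ Suc n) u)) \<longlonglongrightarrow> L lam (K lam u)"
    using limit_functional_tendsto[OF assms, of "K lam u"] by (simp add: funpow_swap1)
qed

text \<open>By \<open>dual_K\<close>, invariance at \<open>u\<close> is the eigenvalue equation at
  \<open>R lam u\<close>, and \<open>R lam\<close> maps onto \<open>DA\<close>: every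
  \<open>v\<close> in \<open>DA\<close> comes from \<open>u = lam v - A v\<close>.\<close>

lemma K_invariant_iff:
  assumes "0 < lam"
  shows "(\<forall>u. blinfun_apply f (K lam u) = f u) \<longleftrightarrow> (\<forall>v\<in>DA. f (A v + B v) = lam * f v)"
proof
  assume inv: "\<forall>u. blinfun_apply f (K lam u) = f u"
  show "\<forall>v\<in>DA. f (A v + B v) = lam * f v"
  proof
    fix v assume "v \<in> DA"
    then show "f (A v + B v) = lam * f v"
      using dual_K[OF assms, of f "lam *\<^sub>R v - A v"] inv by (simp add: R_left assms)
  qed
next
  assume "\<forall>v\<in>DA. f (A v + B v) = lam * f v"
  then show "\<forall>u. blinfun_apply f (K lam u) = f u"
    by (simp add: dual_K assms R_in_DA)
qed

lemma limit_functional_AB: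
  "0 < lam \<Longrightarrow> v \<in> DA \<Longrightarrow> L lam (A v + B v) = lam * L lam v"
  using K_invariant_iff limit_functional_K by blast

section \<open>The Kato series and the change of \<open>lam\<close>\<close>

lemma kato_term_sums: "0 < lam \<Longrightarrow> kato_term DA A B lam u sums RG lam u"
  using kato_sg by (simp add: kato_semigroup_def)

text \<open>Each term satisfies \<open>(lam - A - B) w = K^k u - K^(k+1) u\<close>, so the sum
  telescopes. The remainder \<open>K^n u\<close> need not vanish in the limit, and
  \<open>L lam\<close> measures it.\<close>

lemma partial_sum:
  assumes "0 < lam"
  shows "sum (kato_term DA A B lam u) {..<n} \<in> DA \<and>
    A (sum (kato_term DA A B lam u) {..<n}) + B (sum (kato_term DA A B lam u) {..<n})
      = lam *\<^sub>R sum (kato_term DA A B lam u) {..<n} - u + (K lam ^^ n) u"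
proof (induction n)
  case 0
  have "A (0 + 0) = A 0 + A 0" "B (0 + 0) = B 0 + B 0"
    using subspace_DA by (intro A_add B_add; simp add: subspace_0)+
  then show ?case using subspace_DA by (simp add: subspace_0)
next
  case (Suc n)
  let ?w = "kato_term DA A B lam u n"
  have w: "?w = R lam ((K lam ^^ n) u)" by (simp add: kato_term_def)
  have wD: "?w \<in> DA" unfolding w by (rule R_in_DA[OF assms])
  have Aw: "A ?w = lam *\<^sub>R ?w - (K lam ^^ n) u" unfolding w by (rule A_R[OF assms])
  have Bw: "B ?w = (K lam ^^ Suc n) u" unfolding w by (simp add: K_eq)
  let ?S = "sum (kato_term DA A B lam u) {..<n}"
  have S: "?S \<in> DA" "A ?S + B ?S = lam *\<^sub>R ?S - u + (K lam ^^ n) u"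
    using Suc by blast+
  have "A (?S + ?w) + B (?S + ?w) = (A ?S + B ?S) + (A ?w + B ?w)"
    by (simp add: A_add B_add S(1) wD)
  also have "\<dots> = lam *\<^sub>R (?S + ?w) - u + (K lam ^^ Suc n) u"
    unfolding S(2) Aw Bw by (simp add: scaleR_add_right del: funpow.simps)
  finally show ?case
    using subspace_add[OF subspace_DA S(1) wD] by simp
qed

text \<open>Applying \<open>L mu\<close> to \<open>partial_sum\<close>, where it is an eigenvector
  for \<open>mu\<close>, gives the value \<open>L mu (K^n u)\<close> with \<open>K = K lam\<close>.
  This is at most \<open>Psi (K^n u)\<close>, which tends to \<open>L lam u\<close>.\<close>

lemma limit_functional_shift_le:
  assumes lam: "0 < lam" and mu: "0 < mu" and u: "0 \<le> u"
  shows "L mu (u + (mu - lam) *\<^sub>R RG lam u) \<le> L lam u"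
proof (rule LIMSEQ_le)
  let ?S = "\<lambda>n. sum (kato_term DA A B lam u) {..<n}"
  have "?S \<longlonglongrightarrow> RG lam u" using kato_term_sums[OF lam] by (simp add: sums_def)
  then show "(\<lambda>n. L mu (u + (mu - lam) *\<^sub>R ?S n)) \<longlonglongrightarrow> L mu (u + (mu - lam) *\<^sub>R RG lam u)"
    by (intro blinfun.tendsto tendsto_add tendsto_scaleR tendsto_const)
  show "(\<lambda>n. Psi ((K lam ^^ n) u)) \<longlonglongrightarrow> L lam u" by (rule limit_functional_tendsto[OF lam])
  have "L mu (u + (mu - lam) *\<^sub>R ?S n) = L mu ((K lam ^^ n) u)" for n
    using limit_functional_AB[OF mu, of "?S n"] partial_sum[OF lam, of u n]
    by (simp add: blinfun.add_right blinfun.diff_right blinfun.scaleR_right algebra_simps)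
  moreover have "L mu ((K lam ^^ n) u) \<le> Psi ((K lam ^^ n) u)" for n
    using limit_functional_bounds(2)[OF mu K_funpow_positive[OF lam u]]
    by (simp add: Psi_positive K_funpow_positive lam u)
  ultimately show "\<exists>N. \<forall>n\<ge>N. L mu (u + (mu - lam) *\<^sub>R ?S n) \<le> Psi ((K lam ^^ n) u)"
    by simp
qed

text \<open>For \<open>mu \<ge> lam\<close> the vector \<open>w = u + (mu - lam) RG lam u\<close> is positive, and the previous
  bound, applied to \<open>w\<close> with the roles of \<open>lam\<close> and \<open>mu\<close> exchanged, becomes the reverse bound
  because \<open>RG mu w = RG lam u\<close>.\<close>

lemma limit_functional_shift:
  assumes lam: "0 < lam" and mu: "lam \<le> mu"
  shows "L mu (u + (mu - lam) *\<^sub>R RG lam u) = L lam u"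
proof (rule linear_eq_on_cone[where u = u])
  have lin: "linear (RG lam)" by (rule V.resolvent_generator(4)[OF lam])
  show "linear (\<lambda>u. L mu (u + (mu - lam) *\<^sub>R RG lam u))"
    by (rule linearI)
      (simp_all add: linear_add[OF lin] linear_scale[OF lin] blinfun.add_right
        blinfun.diff_right blinfun.scaleR_right algebra_simps)
  show "linear (L lam)" by (rule linear_blinfun_apply)
  fix u :: 'a assume u: "0 \<le> u"
  define w where "w = u + (mu - lam) *\<^sub>R RG lam u"
  have mu0: "0 < mu" using lam mu by simp
  have w: "0 \<le> w"
    unfolding w_def using V.resolvent_generator(5)[OF lam u] u mu
    by (intro add_nonneg_nonneg scaleR_nonneg_nonneg) simp_all
  have "w = mu *\<^sub>R RG lam u - G (RG lam u)"
    using V.resolvent_generator(2)[OF lam, of u] unfolding w_def by (simp add: algebra_simps)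
  then have "RG mu w = RG lam u"
    using V.resolvent_generator(3)[OF mu0 V.resolvent_generator(1)[OF lam, of u]] by simp
  then have "L lam u \<le> L mu w"
    using limit_functional_shift_le[OF mu0 lam w] by (simp add: w_def algebra_simps)
  then show "L mu (u + (mu - lam) *\<^sub>R RG lam u) = L lam u"
    using limit_functional_shift_le[OF lam mu0 u] unfolding w_def by simp
qed

text \<open>For \<open>u = lam v - G v\<close> one has \<open>RG lam u = v\<close>, and the shifted
  vector is \<open>mu v - G v\<close>. This independence of the parameter makes
  \<open>kato_abar\<close> well defined.\<close>

lemma limit_functional_generator:
  assumes "0 < lam" "0 < mu" "v \<in> generator_dom V"
  shows "L mu (mu *\<^sub>R v - G v) = L lam (lam *\<^sub>R v - G v)"
proof -
  have *: "L mu (mu *\<^sub>R v - G v) = L lam (lam *\<^sub>R v - G v)" if "0 < lam" "lam \<le> mu" for lam mu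
    using limit_functional_shift[OF that, of "lam *\<^sub>R v - G v"]
      V.resolvent_generator(3)[OF that(1) assms(3)]
    by (simp add: algebra_simps)
  show ?thesis
    using *[of lam mu] *[of mu lam] assms by (cases "lam \<le> mu") simp_all
qed

section \<open>The functional \<open>kato_abar\<close> and honesty\<close>

text \<open>With \<open>A w = lam w - K^k u\<close> and \<open>B w = K^(k+1) u\<close>, each term is
  a multiple of \<open>Psi w\<close> plus a telescoping difference, whose sum leaves
  \<open>L lam u\<close> as defect.\<close>

lemma kato_a_sums:
  assumes "0 < lam"
  shows "(\<lambda>k. kato_a A B (kato_term DA A B lam u k)) sums
    (- lam * Psi (RG lam u) + (Psi u - L lam u))"
proof -
  let ?w = "kato_term DA A B lam u"
  have a: "kato_a A B (?w k) =
      - lam * Psi (?w k) + (Psi ((K lam ^^ k) u) - Psi ((K lam ^^ Suc k) u))" for k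
  proof -
    have w: "?w k = R lam ((K lam ^^ k) u)" by (simp add: kato_term_def)
    have "A (?w k) = lam *\<^sub>R ?w k - (K lam ^^ k) u" unfolding w by (rule A_R[OF assms])
    moreover have "B (?w k) = (K lam ^^ Suc k) u" unfolding w by (simp add: K_eq)
    ultimately show ?thesis
      by (simp add: kato_a_def blinfun.add_right blinfun.diff_right blinfun.scaleR_right
          del: funpow.simps)
  qed
  have b: "(\<lambda>k. Psi (?w k)) sums Psi (RG lam u)"
    using bounded_linear.sums[OF blinfun.bounded_linear_right kato_term_sums[OF assms]] .
  have c: "(\<lambda>k. Psi ((K lam ^^ k) u) - Psi ((K lam ^^ Suc k) u)) sums
      (Psi ((K lam ^^ 0) u) - L lam u)"
    by (rule telescope_sums'[OF limit_functional_tendsto[OF assms]])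
  show ?thesis
    unfolding a using sums_add[OF sums_mult[OF b, of "- lam"] c] by (simp only: funpow_0)
qed

lemma kato_abar_eq:
  assumes lam: "0 < lam" and v: "v \<in> generator_dom V"
  shows "kato_abar DA A B V v = - Psi (G v) - L lam (lam *\<^sub>R v - G v)"
proof -
  have s: "(\<lambda>k. kato_a A B (kato_term DA A B mu u k)) sums (- Psi (G v) - L lam (lam *\<^sub>R v - G v))"
    if mu: "0 < mu" and u: "RG mu u = v" for mu u
  proof -
    have ueq: "u = mu *\<^sub>R v - G v" using V.resolvent_generator(2)[OF mu, of u] u by simp
    have "- mu * Psi (RG mu u) + (Psi u - L mu u) = - Psi (G v) - L lam (lam *\<^sub>R v - G v)"
      unfolding u limit_functional_generator[OF lam mu v, symmetric] unfolding ueq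
      by (simp add: blinfun.diff_right blinfun.scaleR_right)
    then show ?thesis using kato_a_sums[OF mu, of u] by simp
  qed
  show ?thesis
    unfolding kato_abar_def
  proof (rule the_equality)
    fix r assume "\<forall>lam>0. \<forall>u. RG lam u = v \<longrightarrow>
      (\<lambda>k. kato_a A B (kato_term DA A B lam u k)) sums r"
    \<comment> \<open>The representation with the given \<open>lam\<close> already determines
      \<open>r\<close>.\<close>
    moreover have "RG lam (lam *\<^sub>R v - G v) = v" by (rule V.resolvent_generator(3)[OF lam v])
    ultimately show "r = - Psi (G v) - L lam (lam *\<^sub>R v - G v)"
      using s[OF lam] lam sums_unique2 by blast
  qed (use s in blast)
qed

lemma honest_iff:
  assumes lam: "0 < lam"
  shows "honest DA A B V \<longleftrightarrow> L lam = 0"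
proof -
  let ?v = "\<lambda>t u. integral {0..t} (\<lambda>s. V s u)"
  \<comment> \<open>The generator maps the integral to \<open>V t u - u\<close>, so the
    \<open>Psi\<close> terms of \<open>kato_abar\<close> cancel the norms and only
    \<open>L lam\<close> remains.\<close>
  have id: "norm (V t u) - norm u = - kato_abar DA A B V (?v t u) \<longleftrightarrow>
      L lam (lam *\<^sub>R ?v t u) = L lam (V t u - u)" if "0 \<le> t" "0 \<le> u" for t u
    using that
    by (auto simp: kato_abar_eq[OF lam V.generator_integral(1)] V.generator_integral(2)
        blinfun.diff_right Psi_positive V.V_positive)
  show ?thesis
  proof
    assume h: "honest DA A B V"
    show "L lam = 0"
    proof (rule dual_eq_0_on_cone)
      fix u :: 'a assume u: "0 \<le> u"
      define q where "q = L lam u"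
      have q0: "0 \<le> q" unfolding q_def by (rule limit_functional_bounds(1)[OF lam u])
      have eq: "lam * L lam (?v t u) = L lam (V t u) - q" if "0 \<le> t" for t
        using h id[OF that u] that u
        by (simp add: honest_def q_def blinfun.diff_right blinfun.scaleR_right)
      have int: "(\<lambda>s. V s u) integrable_on {0..t}" for t
        by (rule integrable_continuous_real, rule continuous_on_subset[OF V.continuous_orbit]) auto
      have ge: "q \<le> L lam (V t u)" if "0 \<le> t" for t
      proof -
        have "0 \<le> ?v t u" by (rule positive_integral[OF int]) (simp add: V.V_positive u)
        then have "0 \<le> lam * L lam (?v t u)" using limit_functional_bounds(1)[OF lam] lam by simp
        then show ?thesis using eq[OF that] by simp
      qed
      \<comment> \<open>The bound \<open>q\<close> holds along the whole orbit, so integrating it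
        gives growth linear in \<open>t\<close>.\<close>
      have lower: "t * q \<le> L lam (?v t u)" if "0 \<le> t" for t
      proof -
        have "integral {0..t} (\<lambda>s. q) \<le> integral {0..t} (L lam \<circ> (\<lambda>s. V s u))"
          by (rule integral_le)
            (use ge integrable_linear[OF int blinfun.bounded_linear_right] in auto)
        then show ?thesis
          using that integral_linear[OF int blinfun.bounded_linear_right, of t "L lam"] by simp
      qed
      show "L lam u = 0"
      proof (rule ccontr)
        assume "L lam u \<noteq> 0"
        then have q: "0 < q" using q0 by (simp add: q_def)
        \<comment> \<open>Chosen so that \<open>lam * (t * q) = norm u\<close>, which exceeds the
          available bound \<open>norm u - q\<close>.\<close>
        define t where "t = norm u / (lam * q)"
        have t: "0 \<le> t" unfolding t_def using lam q by simp
        have "lam * (t * q) \<le> L lam (V t u) - q"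
          using mult_left_mono[OF lower[OF t], of lam] eq[OF t] lam by simp
        also have "L lam (V t u) \<le> norm u"
          using limit_functional_bounds(2)[OF lam V.V_positive[OF t u]] V.V_contractive[OF t u]
          by simp
        finally have "lam * (t * q) \<le> norm u - q" by simp
        moreover have "lam * (t * q) = norm u" unfolding t_def using lam q by simp
        ultimately show False using q by simp
      qed
    qed
  next
    assume "L lam = 0"
    then show "honest DA A B V" unfolding honest_def using id by simp
  qed
qed

text \<open>If \<open>L lam\<close> vanished, \<open>K^n u\<close> would tend to 0 in norm for every
  positive \<open>u\<close>, forcing \<open>f u = 0\<close>. Absolute values admit functionals
  without a sign.\<close>

lemma limit_functional_nonzero:
  fixes f :: "'a dual"
  assumes lam: "0 < lam" and "f \<noteq> 0"
    and le: "\<And>u n. 0 \<le> u \<Longrightarrow> \<bar>blinfun_apply f u\<bar> \<le> \<bar>f ((K lam ^^ n) u)\<bar>"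
  shows "L lam \<noteq> 0"
proof
  assume L0: "L lam = 0"
  have "f = 0"
  proof (rule dual_eq_0_on_cone)
    fix u :: 'a assume u: "0 \<le> u"
    have "(\<lambda>n. norm ((K lam ^^ n) u)) \<longlonglongrightarrow> 0"
      using limit_functional_tendsto[OF lam, of u]
      by (simp add: Psi_positive K_funpow_positive lam u L0)
    then have "(\<lambda>n. norm f * norm ((K lam ^^ n) u)) \<longlonglongrightarrow> 0"
      by (rule tendsto_mult_right_zero)
    moreover have "\<bar>f u\<bar> \<le> norm f * norm ((K lam ^^ n) u)" for n
      using order_trans[OF le[OF u, of n]] norm_blinfun[of f "(K lam ^^ n) u"] by simp
    ultimately have "\<bar>f u\<bar> \<le> 0"
      by (intro LIMSEQ_le_const) auto
    then show "f u = 0" by simp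
  qed
  with \<open>f \<noteq> 0\<close> show False by simp
qed

lemma K_invariant_imp_limit_functional_nonzero:
  fixes f :: "'a dual"
  assumes "0 < lam" "f \<noteq> 0" and inv: "\<And>u. blinfun_apply f (K lam u) = f u"
  shows "L lam \<noteq> 0"
proof (rule limit_functional_nonzero[OF assms(1,2)])
  show "\<bar>f u\<bar> \<le> \<bar>f ((K lam ^^ n) u)\<bar>" for u n
    by (induction n) (simp_all add: inv)
qed

lemma limit_functional_in_dual_cone: "0 < lam \<Longrightarrow> L lam \<in> dual_cone"
  by (simp add: dual_cone_def limit_functional_bounds(1))

lemma adjoint_AB_eq:
  assumes "\<And>v. v \<in> DA \<Longrightarrow> blinfun_apply f (A v + B v) = blinfun_apply g v"
  shows "adjoint_op DA (\<lambda>u. A u + B u) f = g" and "f \<in> adjoint_dom DA (\<lambda>u. A u + B u)"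
  using adjoint_op_eq[OF dense_DA, of f "\<lambda>u. A u + B u" g] assms
  by (auto simp: adjoint_dom_def)

lemma adjoint_AB:
  assumes "f \<in> adjoint_dom DA (\<lambda>u. A u + B u)" and "v \<in> DA"
  shows "blinfun_apply f (A v + B v) = adjoint_op DA (\<lambda>u. A u + B u) f v"
proof -
  obtain g where "\<And>v. v \<in> DA \<Longrightarrow> blinfun_apply f (A v + B v) = blinfun_apply g v"
    using assms(1) unfolding adjoint_dom_def by blast
  with adjoint_AB_eq(1)[OF this] assms(2) show ?thesis by simp
qed

end

theorem theorem3p2:
  fixes DA DB :: "'a::abstract_state_space set"
    and A B :: "'a \<Rightarrow> 'a"
    and V :: "real \<Rightarrow> 'a \<Rightarrow>\<^sub>L 'a"
    and lam :: real
  assumes "kato_conditions DA A DB B"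
    and "kato_semigroup DA A B V"
    and "lam > 0"
  shows "(\<not> honest DA A B V \<longleftrightarrow>
            (\<exists>f. f \<noteq> 0 \<and> (\<exists>g. g \<noteq> 0 \<and>
              limitin weak_star_topology
                (\<lambda>n. (adjoint_op UNIV (BR DA A B lam) ^^ n) f) g sequentially))) \<and>
         (\<not> honest DA A B V \<longleftrightarrow>
            (\<exists>f\<in>dual_cone. f \<noteq> 0 \<and> (\<exists>g. g \<noteq> 0 \<and>
              limitin weak_star_topology
                (\<lambda>n. (adjoint_op UNIV (BR DA A B lam) ^^ n) f) g sequentially))) \<and>
         (\<not> honest DA A B V \<longleftrightarrow>
            (\<exists>f\<in>dual_cone. f \<noteq> 0 \<and> dual_le f (adjoint_op UNIV (BR DA A B lam) f))) \<and>
         (\<not> honest DA A B V \<longleftrightarrow>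
            (\<exists>f\<in>dual_cone. f \<noteq> 0 \<and> f \<in> adjoint_dom DA (\<lambda>u. A u + B u) \<and>
              dual_le (lam *\<^sub>R f) (adjoint_op DA (\<lambda>u. A u + B u) f))) \<and>
         (\<not> honest DA A B V \<longleftrightarrow>
            (\<exists>f\<in>dual_cone. f \<noteq> 0 \<and> f \<in> adjoint_dom DA (\<lambda>u. A u + B u) \<and>
              adjoint_op DA (\<lambda>u. A u + B u) f = lam *\<^sub>R f)) \<and>
         (\<not> honest DA A B V \<longleftrightarrow>
            (\<exists>f. f \<noteq> 0 \<and> f \<in> adjoint_dom DA (\<lambda>u. A u + B u) \<and>
              adjoint_op DA (\<lambda>u. A u + B u) f = lam *\<^sub>R f))"
    (is "(?i \<longleftrightarrow> ?ii) \<and> (_ \<longleftrightarrow> ?iii) \<and> (_ \<longleftrightarrow> ?iv) \<and> (_ \<longleftrightarrow> ?v) \<and> (_ \<longleftrightarrow> ?vi) \<and> (_ \<longleftrightarrow> ?vii)")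
proof -
  interpret kato_locale DA DB A B V using assms(1,2) by unfold_locales
  note lam = \<open>lam > 0\<close>
  note adj = adjoint_op_funpow[OF bounded_linear_K[OF lam]]
  have i: "?i \<longleftrightarrow> L lam \<noteq> 0" using honest_iff[OF lam] by simp
  \<comment> \<open>Three cycles of implications follow: (i), (iii), (ii), (i); then (i), (vi), (v),
    (iv), (i); and (i), (vi), (vii), (i).\<close>
  have i_iii: ?iii if ?i
  proof -
    have L: "L lam \<noteq> 0" using i that by simp
    \<comment> \<open>The witness is \<open>Psi\<close>, whose iterates converge to
      \<open>L lam\<close>; it is nonzero because that limit is.\<close>
    have "Psi \<noteq> (0 :: 'a dual)"
    proof
      assume 0: "Psi = (0 :: 'a dual)"
      have "L lam u = 0" for u
        using limit_functional_tendsto[OF lam, of u] by (simp add: 0 LIMSEQ_const_iff)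
      then show False using L by (simp add: blinfun_eqI)
    qed
    moreover have "limitin weak_star_topology (\<lambda>n. (adjoint_op UNIV (K lam) ^^ n) Psi) (L lam) sequentially"
      unfolding limitin_weak_star_iff adj using limit_functional_tendsto[OF lam] by simp
    ultimately show ?iii using Psi_in_dual_cone L by blast
  qed
  have iii_ii: ?ii if ?iii using that by blast
  have ii_i: ?i if ?ii
  proof -
    obtain f g :: "'a dual" where g: "g \<noteq> 0"
        and "limitin weak_star_topology (\<lambda>n. (adjoint_op UNIV (K lam) ^^ n) f) g sequentially"
      using \<open>?ii\<close> by blast
    then have lim: "(\<lambda>n. f ((K lam ^^ n) u)) \<longlonglongrightarrow> g u" for u
      unfolding limitin_weak_star_iff adj by blast
    \<comment> \<open>The limit \<open>g\<close>, rather than \<open>f\<close>, is invariant under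
      \<open>K\<close>, by an index shift; this is where a nonzero limit matters.\<close>
    have "g (K lam u) = g u" for u
    proof (rule LIMSEQ_unique)
      show "(\<lambda>n. f ((K lam ^^ Suc n) u)) \<longlonglongrightarrow> g u" using LIMSEQ_Suc[OF lim] .
      show "(\<lambda>n. f ((K lam ^^ Suc n) u)) \<longlonglongrightarrow> g (K lam u)"
        using lim[of "K lam u"] by (simp add: funpow_swap1)
    qed
    then show ?i unfolding i by (rule K_invariant_imp_limit_functional_nonzero[OF lam g])
  qed
  have i_vi: ?vi if ?i
  proof -
    have "\<And>v. v \<in> DA \<Longrightarrow> L lam (A v + B v) = (lam *\<^sub>R L lam) v"
      using limit_functional_AB[OF lam] by (simp add: blinfun.scaleR_left)
    from adjoint_AB_eq[OF this] show ?vi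
      using limit_functional_in_dual_cone[OF lam] i that by blast
  qed
  have vi_v: ?v if ?vi
    using that by (auto simp: dual_le_def dual_cone_def)
  have v_iv: ?iv if ?v
  proof -
    obtain f where f: "f \<in> dual_cone" "f \<noteq> 0" "f \<in> adjoint_dom DA (\<lambda>u. A u + B u)"
        and le: "dual_le (lam *\<^sub>R f) (adjoint_op DA (\<lambda>u. A u + B u) f)"
      using \<open>?v\<close> by blast
    have "f u \<le> f (K lam u)" if "0 \<le> u" for u
    proof -
      \<comment> \<open>The inequality between functionals is tested at \<open>R lam u\<close>,
        which is positive; \<open>dual_K\<close> then removes the resolvent.\<close>
      have "lam * f (R lam u) \<le> f (A (R lam u) + B (R lam u))"
        using le R_positive[OF lam that]
        unfolding adjoint_AB[OF f(3) R_in_DA[OF lam]] dual_le_def dual_cone_def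
        by (simp add: blinfun.diff_left blinfun.scaleR_left)
      then show ?thesis using dual_K[OF lam, of f u] by simp
    qed
    then have "dual_le f (adjoint_op UNIV (K lam) f)"
      by (simp add: dual_le_def dual_cone_def blinfun.diff_left
          adjoint_op_bounded_linear[OF bounded_linear_K[OF lam]])
    with f show ?iv by blast
  qed
  have iv_i: ?i if ?iv
  proof -
    obtain f where f: "f \<in> dual_cone" "f \<noteq> 0" "dual_le f (adjoint_op UNIV (K lam) f)"
      using \<open>?iv\<close> by blast
    have step: "f u \<le> f (K lam u)" if "0 \<le> u" for u
      using f(3) that
      by (simp add: dual_le_def dual_cone_def blinfun.diff_left
          adjoint_op_bounded_linear[OF bounded_linear_K[OF lam]])
    have "f u \<le> f ((K lam ^^ n) u)" if "0 \<le> u" for u n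
    proof (induction n)
      case (Suc n)
      then show ?case using step[OF K_funpow_positive[OF lam that, of n]] by simp
    qed simp
    \<comment> \<open>On the cone \<open>f\<close> is nonnegative, so the chain
      \<open>0 \<le> f u \<le> f (K^n u)\<close> gives the bound on absolute values.\<close>
    then have "\<bar>f u\<bar> \<le> \<bar>f ((K lam ^^ n) u)\<bar>" if "0 \<le> u" for u n
      using dual_cone_apply[OF f(1) that] that by (smt (verit))
    then show ?i unfolding i by (rule limit_functional_nonzero[OF lam f(2)])
  qed
  have vi_vii: ?vii if ?vi using that by blast
  have vii_i: ?i if ?vii
  proof -
    obtain f where f: "f \<noteq> 0" "f \<in> adjoint_dom DA (\<lambda>u. A u + B u)"
        and eq: "adjoint_op DA (\<lambda>u. A u + B u) f = lam *\<^sub>R f"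
      using \<open>?vii\<close> by blast
    have "\<forall>v\<in>DA. f (A v + B v) = lam * f v"
      using adjoint_AB[OF f(2)] by (simp add: eq blinfun.scaleR_left)
    then have "\<And>u. f (K lam u) = f u" using K_invariant_iff[OF lam, of f] by blast
    then show ?i unfolding i by (rule K_invariant_imp_limit_functional_nonzero[OF lam f(1)])
  qed
  show ?thesis
    using i_iii iii_ii ii_i i_vi vi_v v_iv iv_i vi_vii vii_i by argo
qed

end
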